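(* Let $\rho^0\in\mathcal{P}_o(G)$, assume that $\mathcal{F}$ is strictly positive definite in $\mathcal{P}(G)$, in the sense that $\lambda_{\min}(\mathrm{Hess}\mathcal{F})>0$, and let $\rho:[0,\infty)\to\mathcal{P}_o(G)$ be the solution of the nonlinear Fokker-Planck equation on $G$, $$\frac{d\rho_i}{dt}=\sum_{j\in N(i)}\omega_{ij}\theta_{ij}(\rho)\big(\mathbb{V}_j-\mathbb{V}_i+(\mathbb{W}\rho)_j-(\mathbb{W}\rho)_i\big)+\beta\sum_{j\in N(i)}\omega_{ij}\theta_{ij}(\rho)(\log\rho_j-\log\rho_i),\qquad i\in V,$$ with $\rho(0)=\rho^0$. Then there exists a constant $C>0$ such that for all $t\ge 0$ $$\mathcal{F}(\rho(t))-\mathcal{F}(\rho^\infty)\le e^{-Ct}\big(\mathcal{F}(\rho^0)-\mathcal{F}(\rho^\infty)\big).$$ Furthermore, $$C=2m(\rho^0)\,\lambda_{sec}(\hat L)\,\lambda_{\min}(\mathrm{Hess}\mathcal{F})\,\frac{1}{(r+1)^2},$$ where $$r=\sqrt2\,\mathrm{Deg}(G)\,\max_{(i,j)\in E}\omega_{ij}\;\frac{\|\mathrm{Hess}\mathcal{F}\|_1}{\lambda_{\min}(\mathrm{Hess}\mathcal{F})^{3/2}}\;\frac{1-m(\rho^0)}{m(\rho^0)^2}\;\frac{\lambda_{\max}(\hat L)}{\lambda_{sec}(\hat L)^2}\;\sqrt{\mathcal{F}(\rho^0)-\mathcal{F}(\rho^\infty)}.$$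
   Context: $G=(V,E,\omega)$ is a finite connected undirected weighted graph without self loops or multiple edges, $V=\{1,\dots,n\}$, with symmetric weights $\omega_{ij}=\omega_{ji}>0$ if $(i,j)\in E$ and $\omega_{ij}=0$ otherwise; $E$ is regarded as a symmetric set of ordered pairs, so each edge is counted twice in $\sum_{(i,j)\in E}$. $N(i)=\{j\in V: (i,j)\in E\}$; $\mathrm{Deg}(G)=\max_i|N(i)|$ is the maximal degree. $\mathcal{P}(G)=\{\rho\in\mathbb{R}^n:\sum_i\rho_i=1,\ \rho_i\ge0\}$ and $\mathcal{P}_o(G)$ is its interior (all $\rho_i>0$). $\theta_{ij}(\rho)=\frac{\rho_i+\rho_j}{2}$ for $(i,j)\in E$. The free energy is $\mathcal{F}(\rho)=\frac12\rho^T\mathbb{W}\rho+\mathbb{V}^T\rho+\beta\sum_{i=1}^n\rho_i\log\rho_i$, where $\beta>0$, $\mathbb{V}\in\mathbb{R}^n$ and $\mathbb{W}\in\mathbb{R}^{n\times n}$ is symmetric. $\mathrm{Hess}\mathcal{F}(\rho)=\big(\partial^2\mathcal{F}/\partial\rho_i\partial\rho_j\big)_{i,j}$ is its Hessian matrix. $\rho^\infty$ is the Gibbs measure, i.e. the solution of $\rho^\infty_i=\frac1K e^{-\frac{(\mathbb{W}\rho^\infty)_i+\mathbb{V}_i}{\beta}}$, $K=\sum_{j=1}^n e^{-\frac{(\mathbb{W}\rho^\infty)_j+\mathbb{V}_j}{\beta}}$. $\hat L$ is the weighted graph Laplacian matrix: $\Phi^T\hat L\Phi=\frac12\sum_{(i,j)\in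 E}\omega_{ij}(\Phi_i-\Phi_j)^2$ for $\Phi\in\mathbb{R}^n$; $\lambda_{sec}(\hat L)$ and $\lambda_{\max}(\hat L)$ are its second smallest and largest eigenvalues. $\|\mathrm{Hess}\mathcal{F}\|_1=\sup_{\rho\in\mathcal{P}(G)}\|\mathrm{Hess}\mathcal{F}(\rho)\|_1$, where $\|A\|_1=\max_j\sum_i|A_{ij}|$, and $\lambda_{\min}(\mathrm{Hess}\mathcal{F})=\min_{\rho\in\mathcal{P}(G)}\lambda_{\min}(\mathrm{Hess}\mathcal{F}(\rho))$, where $\lambda_{\min}(A)$ is the smallest eigenvalue of a symmetric matrix $A$. $M=\exp\big(2\sup_{i,j\in V}(|\mathbb{V}_i|+|\mathbb{W}_{ij}|)\big)$ and $$m(\rho^0)=\frac12\Big(\frac{1}{1+(2M)^{1/\beta}}\Big)^{n-2}\min\Big\{\frac{1}{1+(2M)^{1/\beta}},\ \min_{i\in V}\rho^0_i\Big\}>0.$$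
   Formalization: The sup defining ‖Hess F‖_1 is over ρ∈P(G) with all ρ_i ≥ m(ρ^0), since over P(G) it is +∞ (β/ρ_i unbounded), giving C=0; λ_min(Hess F) is the infimum over P_o(G), as the Hessian is undefined on the boundary; n≥2 is assumed so that λ_sec exists. *)

theory Defs
  imports "HOL-Analysis.Analysis" "HOL-Library.Multiset"
begin

section \<open>Weighted graphs\<close>

text \<open>The vertex set is the finite type \<open>'n\<close>, so \<open>n\<close> is \<open>CARD('n)\<close>. The edge set is a
  symmetric set of ordered pairs, so sums over \<open>E\<close> count every edge twice.\<close>

definition weighted_graph :: "('n::finite \<times> 'n) set \<Rightarrow> real^'n^'n \<Rightarrow> bool" where
  "weighted_graph E \<omega> \<longleftrightarrow>
     sym E \<and> irrefl E \<and>
     (\<forall>i j. \<omega> $ i $ j = \<omega> $ j $ i) \<and>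
     (\<forall>i j. (i, j) \<in> E \<longrightarrow> \<omega> $ i $ j > 0) \<and>
     (\<forall>i j. (i, j) \<notin> E \<longrightarrow> \<omega> $ i $ j = 0)"

definition connected_graph :: "('n::finite \<times> 'n) set \<Rightarrow> bool" where
  "connected_graph E \<longleftrightarrow> (\<forall>i j. (i, j) \<in> E\<^sup>*)"

definition nbhd :: "('n::finite \<times> 'n) set \<Rightarrow> 'n \<Rightarrow> 'n set" where
  "nbhd E i = {j. (i, j) \<in> E}"

definition max_degree :: "('n::finite \<times> 'n) set \<Rightarrow> nat" where
  "max_degree E = Max (range (\<lambda>i. card (nbhd E i)))"

definition max_weight :: "('n::finite \<times> 'n) set \<Rightarrow> real^'n^'n \<Rightarrow> real" where
  "max_weight E \<omega> = Max ((\<lambda>(i, j). \<omega> $ i $ j) ` E)"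

definition laplacian :: "real^'n^'n \<Rightarrow> real^'n^'n::finite" where
  "laplacian \<omega> = (\<chi> i j. if i = j then (\<Sum>k\<in>UNIV. \<omega> $ i $ k) - \<omega> $ i $ i else - \<omega> $ i $ j)"

text \<open>The quadratic form that characterises the symmetric matrix \<open>laplacian \<omega>\<close>.\<close>

lemma laplacian_quadratic_form:
  fixes \<omega> :: "real^'n^'n::finite"
  assumes "weighted_graph E \<omega>"
  shows "\<Phi> \<bullet> (laplacian \<omega> *v \<Phi>) = 1/2 * (\<Sum>(i, j)\<in>E. \<omega> $ i $ j * (\<Phi> $ i - \<Phi> $ j)^2)"
proof -
  have sy: "\<omega> $ i $ j = \<omega> $ j $ i" and z: "(i, j) \<notin> E \<Longrightarrow> \<omega> $ i $ j = 0" for i j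
    using assms by (auto simp: weighted_graph_def)
  have "(\<Sum>(i, j)\<in>E. \<omega> $ i $ j * (\<Phi> $ i - \<Phi> $ j)^2)
      = (\<Sum>(i, j)\<in>UNIV. \<omega> $ i $ j * (\<Phi> $ i - \<Phi> $ j)^2)"
    by (rule sum.mono_neutral_left) (auto simp: z)
  also have "\<dots> = (\<Sum>i\<in>UNIV. \<Sum>j\<in>UNIV. \<omega> $ i $ j * (\<Phi> $ i - \<Phi> $ j)^2)"
    by (simp add: sum.cartesian_product)
  also have "\<dots> = (\<Sum>i\<in>UNIV. \<Sum>j\<in>UNIV. \<omega> $ i $ j * (\<Phi> $ i)^2)
      + (\<Sum>i\<in>UNIV. \<Sum>j\<in>UNIV. \<omega> $ i $ j * (\<Phi> $ j)^2)
      - 2 * (\<Sum>i\<in>UNIV. \<Sum>j\<in>UNIV. \<omega> $ i $ j * \<Phi> $ i * \<Phi> $ j)"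
    by (simp add: power2_eq_square algebra_simps sum.distrib sum_subtractf sum_distrib_left)
  also have "(\<Sum>i\<in>UNIV. \<Sum>j\<in>UNIV. \<omega> $ i $ j * (\<Phi> $ j)^2)
      = (\<Sum>i\<in>UNIV. \<Sum>j\<in>UNIV. \<omega> $ i $ j * (\<Phi> $ i)^2)"
    by (subst sum.swap) (simp add: sy)
  finally have rhs: "1/2 * (\<Sum>(i, j)\<in>E. \<omega> $ i $ j * (\<Phi> $ i - \<Phi> $ j)^2)
      = (\<Sum>i\<in>UNIV. \<Sum>j\<in>UNIV. \<omega> $ i $ j * (\<Phi> $ i)^2)
        - (\<Sum>i\<in>UNIV. \<Sum>j\<in>UNIV. \<omega> $ i $ j * \<Phi> $ i * \<Phi> $ j)"
    by simp
  have L: "laplacian \<omega> $ i $ j = (if i = j then \<Sum>k\<in>UNIV. \<omega> $ i $ k else 0) - \<omega> $ i $ j" for i j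
    by (auto simp: laplacian_def)
  have "(laplacian \<omega> *v \<Phi>) $ i
      = (\<Sum>k\<in>UNIV. \<omega> $ i $ k) * \<Phi> $ i - (\<Sum>j\<in>UNIV. \<omega> $ i $ j * \<Phi> $ j)" for i
    by (simp add: matrix_vector_mult_def L left_diff_distrib sum_subtractf if_distrib
        [where f = "\<lambda>x. x * _"] cong: if_cong)
  then have "\<Phi> \<bullet> (laplacian \<omega> *v \<Phi>)
      = (\<Sum>i\<in>UNIV. \<Phi> $ i * ((\<Sum>k\<in>UNIV. \<omega> $ i $ k) * \<Phi> $ i - (\<Sum>j\<in>UNIV. \<omega> $ i $ j * \<Phi> $ j)))"
    by (simp add: inner_vec_def)
  also have "\<dots> = (\<Sum>i\<in>UNIV. \<Sum>j\<in>UNIV. \<omega> $ i $ j * (\<Phi> $ i)^2)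
        - (\<Sum>i\<in>UNIV. \<Sum>j\<in>UNIV. \<omega> $ i $ j * \<Phi> $ i * \<Phi> $ j)"
    by (simp add: power2_eq_square right_diff_distrib sum_subtractf sum_distrib_left
        sum_distrib_right mult_ac)
  finally show ?thesis using rhs by simp
qed


section \<open>Eigenvalues of symmetric matrices\<close>

definition eigenspace :: "real^'n^'n \<Rightarrow> real \<Rightarrow> (real^'n::finite) set" where
  "eigenspace A l = {x. A *v x = l *\<^sub>R x}"

definition spectrum :: "real^'n^'n::finite \<Rightarrow> real set" where
  "spectrum A = {l. \<exists>x \<in> eigenspace A l. x \<noteq> 0}"

text \<open>For a symmetric matrix geometric and algebraic multiplicities agree, so this is the
  ascending list of all \<open>n\<close> eigenvalues, repeated according to multiplicity.\<close>

definition eigenvalue_list :: "real^'n^'n::finite \<Rightarrow> real list" where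
  "eigenvalue_list A =
     sorted_list_of_multiset (\<Sum>l\<in>spectrum A. replicate_mset (dim (eigenspace A l)) l)"

definition lambda_min :: "real^'n^'n::finite \<Rightarrow> real" where
  "lambda_min A = Min (spectrum A)"

definition lambda_max :: "real^'n^'n::finite \<Rightarrow> real" where
  "lambda_max A = Max (spectrum A)"

definition lambda_sec :: "real^'n^'n::finite \<Rightarrow> real" where
  "lambda_sec A = eigenvalue_list A ! 1"

definition mat_norm1 :: "real^'n^'n::finite \<Rightarrow> real" where
  "mat_norm1 A = Max (range (\<lambda>j. \<Sum>i\<in>UNIV. \<bar>A $ i $ j\<bar>))"


section \<open>Free energy and Hessian\<close>

definition simplex_int :: "(real^'n::finite) set" where
  "simplex_int = {\<rho>. (\<Sum>i\<in>UNIV. \<rho> $ i) = 1 \<and> (\<forall>i. \<rho> $ i > 0)}"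

definition free_energy :: "real^'n^'n \<Rightarrow> real^'n \<Rightarrow> real \<Rightarrow> real^'n::finite \<Rightarrow> real" where
  "free_energy W V \<beta> \<rho> =
     1/2 * (\<rho> \<bullet> (W *v \<rho>)) + V \<bullet> \<rho> + \<beta> * (\<Sum>i\<in>UNIV. \<rho> $ i * ln (\<rho> $ i))"

definition partial :: "'n \<Rightarrow> (real^'n::finite \<Rightarrow> real) \<Rightarrow> real^'n \<Rightarrow> real" where
  "partial i f \<rho> = deriv (\<lambda>s. f (\<rho> + s *\<^sub>R axis i 1)) 0"

definition hessian :: "(real^'n::finite \<Rightarrow> real) \<Rightarrow> real^'n \<Rightarrow> real^'n^'n" where
  "hessian f \<rho> = (\<chi> i j. partial i (partial j f) \<rho>)"

text \<open>The entropy is twice differentiable only where all \<open>\<rho>\<^sub>i > 0\<close>; there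
  \<open>\<partial>\<^sub>i\<partial>\<^sub>jF = W\<^sub>i\<^sub>j + \<delta>\<^sub>i\<^sub>j \<beta>/\<rho>\<^sub>i\<close>. On the boundary of the simplex the
  Hessian is to be read with diagonal entries \<open>+\<infinity>\<close>, i.e. the smallest eigenvalue is there
  the limit from the interior; the minimum over the closed simplex is therefore the infimum over
  the interior. Evaluating the total function \<open>hessian\<close> at boundary points would
  produce arbitrary values.\<close>

definition hess_lambda_min :: "(real^'n::finite \<Rightarrow> real) \<Rightarrow> real" where
  "hess_lambda_min f = (INF \<rho>\<in>simplex_int. lambda_min (hessian f \<rho>))"

definition hess_norm1 :: "(real^'n::finite \<Rightarrow> real) \<Rightarrow> (real^'n) set \<Rightarrow> real" where
  "hess_norm1 f S = (SUP \<rho>\<in>S. mat_norm1 (hessian f \<rho>))"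

definition gibbs_measure :: "real^'n^'n \<Rightarrow> real^'n \<Rightarrow> real \<Rightarrow> real^'n::finite \<Rightarrow> bool" where
  "gibbs_measure W V \<beta> \<rho> \<longleftrightarrow>
     (let K = (\<Sum>j\<in>UNIV. exp (- ((W *v \<rho>) $ j + V $ j) / \<beta>))
      in \<forall>i. \<rho> $ i = 1 / K * exp (- ((W *v \<rho>) $ i + V $ i) / \<beta>))"


section \<open>The Fokker-Planck equation\<close>

definition edge_mean :: "real^'n::finite \<Rightarrow> 'n \<Rightarrow> 'n \<Rightarrow> real" where
  "edge_mean \<rho> i j = (\<rho> $ i + \<rho> $ j) / 2"

definition fokker_planck_rhs ::
    "('n::finite \<times> 'n) set \<Rightarrow> real^'n^'n \<Rightarrow> real^'n^'n \<Rightarrow> real^'n \<Rightarrow> real \<Rightarrow> real^'n \<Rightarrow> real^'n" where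
  "fokker_planck_rhs E \<omega> W V \<beta> \<rho> = (\<chi> i.
     (\<Sum>j\<in>nbhd E i. \<omega> $ i $ j * edge_mean \<rho> i j *
        (V $ j - V $ i + (W *v \<rho>) $ j - (W *v \<rho>) $ i))
     + \<beta> * (\<Sum>j\<in>nbhd E i. \<omega> $ i $ j * edge_mean \<rho> i j * (ln (\<rho> $ j) - ln (\<rho> $ i))))"

definition fokker_planck_solution ::
    "('n::finite \<times> 'n) set \<Rightarrow> real^'n^'n \<Rightarrow> real^'n^'n \<Rightarrow> real^'n \<Rightarrow> real \<Rightarrow> real^'n \<Rightarrow>
     (real \<Rightarrow> real^'n) \<Rightarrow> bool" where
  "fokker_planck_solution E \<omega> W V \<beta> \<rho>0 \<rho> \<longleftrightarrow>
     \<rho> 0 = \<rho>0 \<and>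
     (\<forall>t\<ge>0. \<rho> t \<in> simplex_int \<and>
        (\<rho> has_vector_derivative fokker_planck_rhs E \<omega> W V \<beta> (\<rho> t)) (at t within {0..}))"


section \<open>The constants of the convergence rate\<close>

definition M_const :: "real^'n^'n \<Rightarrow> real^'n::finite \<Rightarrow> real" where
  "M_const W V = exp (2 * Max (range (\<lambda>(i, j). \<bar>V $ i\<bar> + \<bar>W $ i $ j\<bar>)))"

definition m_const :: "real^'n^'n \<Rightarrow> real^'n \<Rightarrow> real \<Rightarrow> real^'n::finite \<Rightarrow> real" where
  "m_const W V \<beta> \<rho>0 =
     1/2 * (1 / (1 + (2 * M_const W V) powr (1/\<beta>))) ^ (CARD('n) - 2)
         * min (1 / (1 + (2 * M_const W V) powr (1/\<beta>))) (Min (range (\<lambda>i. \<rho>0 $ i)))"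

text \<open>The diagonal of the Hessian contains \<open>\<beta>/\<rho>\<^sub>i\<close>, so the supremum of its 1-norm over the
  whole simplex is \<open>+\<infinity>\<close> and has no real value. The supremum is taken over
  the following compact part of the simplex, which is invariant under the Fokker-Planck flow from
  \<open>\<rho>0\<close>. A supremum over any larger set gives a larger \<open>r\<close> and hence a smaller rate.\<close>

definition invariant_region :: "real^'n^'n \<Rightarrow> real^'n \<Rightarrow> real \<Rightarrow> real^'n \<Rightarrow> (real^'n::finite) set" where
  "invariant_region W V \<beta> \<rho>0 = {\<rho> \<in> simplex_int. \<forall>i. m_const W V \<beta> \<rho>0 \<le> \<rho> $ i}"

definition r_const ::
    "('n::finite \<times> 'n) set \<Rightarrow> real^'n^'n \<Rightarrow> real^'n^'n \<Rightarrow> real^'n \<Rightarrow> real \<Rightarrow> real^'n \<Rightarrow> real^'n \<Rightarrow> real"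
  where
  "r_const E \<omega> W V \<beta> \<rho>0 \<rho>inf =
     (let F = free_energy W V \<beta>; m = m_const W V \<beta> \<rho>0; L = laplacian \<omega>
      in sqrt 2 * real (max_degree E) * max_weight E \<omega>
         * (hess_norm1 F (invariant_region W V \<beta> \<rho>0) / hess_lambda_min F powr (3/2))
         * ((1 - m) / m^2)
         * (lambda_max L / (lambda_sec L)^2)
         * sqrt (F \<rho>0 - F \<rho>inf))"

end

theory Submission
  imports Defs
begin

text \<open>The flow is \<open>\<rho>' = - L(\<rho>) g\<close>, where \<open>g = \<nabla>F(\<rho>)\<close> and \<open>L(\<rho>)\<close> is the Laplacian with
  weights \<open>\<omega>\<^sub>i\<^sub>j \<theta>\<^sub>i\<^sub>j(\<rho>)\<close>. Since \<open>\<rho>\<close> never falls below \<open>m\<close>, the dissipation \<open>g \<bullet> L(\<rho>) g\<close> is at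
  least \<open>m \<lambda>\<^sub>s\<^sub>e\<^sub>c\<close> times the squared norm of the mean-free part of \<open>g\<close>. Strong convexity of \<open>F\<close> on
  the simplex bounds that squared norm below by \<open>2 \<lambda>\<^sub>m\<^sub>i\<^sub>n (F(\<rho>) - F(\<rho>\<^sup>\<infinity>))\<close> (a Polyak-Lojasiewicz
  inequality). This gives exponential decay at rate \<open>2 m \<lambda>\<^sub>s\<^sub>e\<^sub>c \<lambda>\<^sub>m\<^sub>i\<^sub>n\<close>, so the factor
  \<open>1/(r + 1)\<^sup>2\<close> in the stated rate only requires \<open>r \<ge> 0\<close>.\<close>

section \<open>Spectra of symmetric matrices\<close>

lemma symmetric_matrix_inner:
  fixes A :: "real^'n^'n::finite"
  assumes "transpose A = A"
  shows "x \<bullet> (A *v y) = (A *v x) \<bullet> y"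
  by (metis assms dot_lmul_matrix transpose_matrix_vector)

text \<open>Compactness of the unit sphere of \<open>S\<close> yields a minimiser of the quadratic
  form, and the first variation along its residual shows that it is an eigenvector. It serves twice:
  on the whole space for \<open>lambda_min\<close>, and on the complement of the constants for
  \<open>lambda_sec\<close>.\<close>

lemma rayleigh_minimiser:
  fixes A :: "real^'n^'n::finite"
  assumes sym: "transpose A = A" and S: "subspace S" and inv: "\<And>x. x \<in> S \<Longrightarrow> A *v x \<in> S"
    and ne: "\<exists>x\<in>S. x \<noteq> 0"
  obtains x l where "x \<in> S" "x \<noteq> 0" "A *v x = l *\<^sub>R x"
    "\<And>y. y \<in> S \<Longrightarrow> l * (y \<bullet> y) \<le> y \<bullet> (A *v y)"
proof -
  have cl: "closed S" using S by (rule closed_subspace)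
  have comp: "compact (S \<inter> sphere 0 1)"
    using cl by (simp add: closed_Int_compact)
  obtain z where z: "z \<in> S" "z \<noteq> 0" using ne by blast
  have "(1 / norm z) *\<^sub>R z \<in> S \<inter> sphere 0 1"
    using z S by (auto simp: subspace_scale)
  then have nonempty: "S \<inter> sphere 0 1 \<noteq> {}" by blast
  have "continuous_on (S \<inter> sphere 0 1) (\<lambda>x. x \<bullet> (A *v x))"
    by (intro continuous_intros linear_continuous_on matrix_vector_mul_bounded_linear)
  from continuous_attains_inf[OF comp nonempty this]
  obtain x where x: "x \<in> S" "norm x = 1"
    and min: "\<And>y. y \<in> S \<Longrightarrow> norm y = 1 \<Longrightarrow> x \<bullet> (A *v x) \<le> y \<bullet> (A *v y)"
    by auto
  define l where "l = x \<bullet> (A *v x)"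
  define B where "B y = y \<bullet> (A *v y) - l * (y \<bullet> y)" for y
  have B0: "B y \<ge> 0" if "y \<in> S" for y
  proof (cases "y = 0")
    case False
    have "l \<le> ((1 / norm y) *\<^sub>R y) \<bullet> (A *v ((1 / norm y) *\<^sub>R y))"
      unfolding l_def by (rule min) (use that S False in \<open>auto simp: subspace_scale\<close>)
    also have "\<dots> = (y \<bullet> (A *v y)) / (y \<bullet> y)"
      by (simp add: matrix_vector_mult_scaleR dot_square_norm power2_eq_square)
    finally show ?thesis using False by (simp add: B_def field_simps)
  qed (simp add: B_def)
  \<comment> \<open>Invariance keeps the residual in \<open>S\<close>, so the form \<open>B\<close>,
    nonnegative on \<open>S\<close> and zero at \<open>x\<close>, may be tested at
    \<open>x + t *\<^sub>R v\<close>.\<close>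
  define v where "v = A *v x - l *\<^sub>R x"
  have v: "v \<in> S" unfolding v_def using x inv S by (simp add: subspace_diff subspace_scale)
  have xx: "x \<bullet> x = 1" using x by (simp add: dot_square_norm)
  have exp: "B (x + t *\<^sub>R v) = 2 * t * (v \<bullet> v) + t\<^sup>2 * B v" for t
  proof -
    have "B (x + t *\<^sub>R v) = B x + t * (x \<bullet> (A *v v) + v \<bullet> (A *v x) - 2 * l * (x \<bullet> v)) + t\<^sup>2 * B v"
      by (simp add: B_def matrix_vector_right_distrib matrix_vector_mult_scaleR
          inner_commute power2_eq_square algebra_simps)
    moreover have "B x = 0" by (simp add: B_def l_def xx)
    moreover have "x \<bullet> (A *v v) + v \<bullet> (A *v x) - 2 * l * (x \<bullet> v) = 2 * (v \<bullet> v)"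
    proof -
      have "v \<bullet> v = (A *v x) \<bullet> v - l * (x \<bullet> v)" by (subst (1) v_def) (simp add: inner_diff_left)
      then show ?thesis using symmetric_matrix_inner[OF sym, of x v] by (simp add: inner_commute)
    qed
    ultimately show ?thesis by simp
  qed
  have "v = 0"
  proof (rule ccontr)
    assume "v \<noteq> 0"
    then have c: "v \<bullet> v > 0" by simp
    define q where "q = B v"
    have q: "q \<ge> 0" using B0 v by (simp add: q_def)
    \<comment> \<open>This negative step gives \<open>t * q \<ge> - (v \<bullet> v)\<close>, so the
      linear term dominates and \<open>B\<close> would become negative; the \<open>+ 1\<close>
      covers \<open>q = 0\<close>.\<close>
    define t where "t = - (v \<bullet> v) / (q + 1)"
    have "t < 0" using c q by (simp add: t_def field_simps)
    have "0 \<le> B (x + t *\<^sub>R v)" using x v S by (intro B0) (simp add: subspace_add subspace_scale)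
    then have "0 \<le> t * (2 * (v \<bullet> v) + t * q)"
      unfolding exp by (simp add: q_def algebra_simps power2_eq_square)
    then have "2 * (v \<bullet> v) + t * q \<le> 0" using \<open>t < 0\<close> by (simp add: zero_le_mult_iff)
    moreover have "t * q = - (v \<bullet> v) * (q / (q + 1))" by (simp add: t_def)
    moreover have "(v \<bullet> v) * (q / (q + 1)) \<le> (v \<bullet> v) * 1"
      using c q by (intro mult_left_mono) auto
    ultimately show False using c by simp
  qed
  then show ?thesis using x B0 xx by (intro that[of x l]) (auto simp: v_def B_def)
qed

text \<open>Eigenvectors for distinct eigenvalues are orthogonal, and a pairwise orthogonal set is
  finite in finite dimension. This gives \<open>Min\<close>, \<open>Max\<close> and sums over the
  spectrum their intended meaning.\<close>

lemma finite_spectrum: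
  fixes A :: "real^'n^'n::finite"
  assumes sym: "transpose A = A"
  shows "finite (spectrum A)"
proof -
  have "\<exists>f. \<forall>l\<in>spectrum A. A *v f l = l *\<^sub>R f l \<and> f l \<noteq> 0"
    by (intro bchoice) (auto simp: spectrum_def eigenspace_def)
  then obtain f where f: "\<And>l. l \<in> spectrum A \<Longrightarrow> A *v f l = l *\<^sub>R f l"
    "\<And>l. l \<in> spectrum A \<Longrightarrow> f l \<noteq> 0" by blast
  have orth: "f k \<bullet> f l = 0" if "k \<in> spectrum A" "l \<in> spectrum A" "k \<noteq> l" for k l
    using symmetric_matrix_inner[OF sym, of "f k" "f l"] f that by auto
  have "inj_on f (spectrum A)"
    by (rule inj_onI) (metis f(2) inner_eq_zero_iff orth)
  moreover have "finite (f ` spectrum A)"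
    by (rule pairwise_orthogonal_imp_finite) (auto simp: pairwise_def orthogonal_def intro!: orth)
  ultimately show ?thesis by (simp add: finite_image_iff)
qed

text \<open>The Rayleigh minimum over the whole space is itself an eigenvalue, so the spectrum is
  nonempty and its least element inherits the bound.\<close>

lemma lambda_min_symmetric:
  fixes A :: "real^'n^'n::finite"
  assumes sym: "transpose A = A"
  shows "lambda_min A \<in> spectrum A"
    and "lambda_min A * (y \<bullet> y) \<le> y \<bullet> (A *v y)"
proof -
  have "\<exists>x\<in>(UNIV::(real^'n) set). x \<noteq> 0"
    by (intro bexI[of _ 1]) auto
  then obtain x l where x: "x \<noteq> 0" "A *v x = l *\<^sub>R x"
    "\<And>y. l * (y \<bullet> y) \<le> y \<bullet> (A *v y)"
    using rayleigh_minimiser[OF sym subspace_UNIV] by (metis UNIV_I)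
  have l: "l \<in> spectrum A" using x by (auto simp: spectrum_def eigenspace_def)
  have fin: "finite (spectrum A)" by (rule finite_spectrum[OF sym])
  show "lambda_min A \<in> spectrum A"
    unfolding lambda_min_def using fin l by (intro Min_in) auto
  have "lambda_min A \<le> l" unfolding lambda_min_def using fin l by simp
  then have "lambda_min A * (y \<bullet> y) \<le> l * (y \<bullet> y)" by (simp add: mult_right_mono)
  then show "lambda_min A * (y \<bullet> y) \<le> y \<bullet> (A *v y)" using x(3)[of y] by linarith
qed

section \<open>The graph Laplacian\<close>

context
  fixes E :: "('n::finite \<times> 'n) set" and \<omega> :: "real^'n^'n"
  assumes graph: "weighted_graph E \<omega>"
begin

lemma weight_eq_0: "(i, j) \<notin> E \<Longrightarrow> \<omega> $ i $ j = 0"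
  using graph unfolding weighted_graph_def by blast

lemma weight_nonneg: "\<omega> $ i $ j \<ge> 0"
  using graph unfolding weighted_graph_def by (cases "(i, j) \<in> E") (blast intro: less_imp_le, simp)

lemma laplacian_symmetric: "transpose (laplacian \<omega>) = laplacian \<omega>"
proof -
  have "\<omega> $ i $ j = \<omega> $ j $ i" for i j using graph by (simp add: weighted_graph_def)
  then show ?thesis by (simp add: laplacian_def transpose_def vec_eq_iff)
qed

lemma laplacian_nonneg: "0 \<le> x \<bullet> (laplacian \<omega> *v x)"
  unfolding laplacian_quadratic_form[OF graph]
  by (auto intro!: sum_nonneg simp: weight_nonneg)

lemma laplacian_one: "laplacian \<omega> *v 1 = 0"
proof -
  have "laplacian \<omega> $ i $ j = (if i = j then \<Sum>k\<in>UNIV. \<omega> $ i $ k else 0) - \<omega> $ i $ j" for i j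
    by (auto simp: laplacian_def)
  then show ?thesis by (simp add: vec_eq_iff matrix_vector_mult_def sum_subtractf)
qed

lemma laplacian_spectrum_nonneg:
  assumes "l \<in> spectrum (laplacian \<omega>)" shows "l \<ge> 0"
proof -
  obtain x where x: "laplacian \<omega> *v x = l *\<^sub>R x" "x \<noteq> 0"
    using assms by (auto simp: spectrum_def eigenspace_def)
  then have "0 \<le> l * (x \<bullet> x)" using laplacian_nonneg[of x] by simp
  moreover have "x \<bullet> x > 0" using x by simp
  ultimately show ?thesis by (simp add: zero_le_mult_iff)
qed

lemma zero_in_laplacian_spectrum: "0 \<in> spectrum (laplacian \<omega>)"
  by (auto simp: spectrum_def eigenspace_def laplacian_one intro!: exI[of _ 1])

lemma lambda_max_laplacian_nonneg: "lambda_max (laplacian \<omega>) \<ge> 0"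
  unfolding lambda_max_def
  by (intro Max_ge finite_spectrum laplacian_symmetric zero_in_laplacian_spectrum)

context
  assumes conn: "connected_graph E"
begin

text \<open>A vanishing sum of nonnegative edge terms makes \<open>x\<close> agree across every
  edge, and connectedness propagates this along paths.\<close>

lemma laplacian_eq_0_imp_const:
  assumes "x \<bullet> (laplacian \<omega> *v x) = 0"
  shows "x $ i = x $ j"
proof -
  have "(\<Sum>(i, j)\<in>E. \<omega> $ i $ j * (x $ i - x $ j)\<^sup>2) = 0"
    using assms unfolding laplacian_quadratic_form[OF graph] by simp
  then have all: "\<forall>e\<in>E. (case e of (i, j) \<Rightarrow> \<omega> $ i $ j * (x $ i - x $ j)\<^sup>2) = 0"
    by (subst (asm) sum_nonneg_eq_0_iff) (auto simp: weight_nonneg)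
  then have edge: "x $ i = x $ j" if "(i, j) \<in> E" for i j
  proof -
    have "\<omega> $ i $ j > 0" using that graph unfolding weighted_graph_def by blast
    moreover have "\<omega> $ i $ j * (x $ i - x $ j)\<^sup>2 = 0" using all that by auto
    ultimately show ?thesis by simp
  qed
  have "(i, j) \<in> E\<^sup>*" using conn by (simp add: connected_graph_def)
  then show ?thesis by (induction rule: rtrancl_induct) (auto dest: edge)
qed

lemma eigenspace_laplacian_0: "eigenspace (laplacian \<omega>) 0 = span {1}"
proof
  show "eigenspace (laplacian \<omega>) 0 \<subseteq> span {1}"
  proof
    fix x assume "x \<in> eigenspace (laplacian \<omega>) 0"
    then have "x \<bullet> (laplacian \<omega> *v x) = 0" by (simp add: eigenspace_def)
    then have "x $ i = x $ undefined" for i by (rule laplacian_eq_0_imp_const)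
    then have "x = (x $ undefined) *\<^sub>R 1" by (simp add: vec_eq_iff)
    then show "x \<in> span {1}" by (metis span_base span_scale insertI1)
  qed
  show "span {1} \<subseteq> eigenspace (laplacian \<omega>) 0"
    by (auto simp: span_singleton eigenspace_def matrix_vector_mult_scaleR laplacian_one)
qed

text \<open>Connectedness makes the eigenvalue 0 simple, so the entry at index 1 is the least
  positive eigenvalue. The Rayleigh minimum on the complement of the constants is one of the
  positive eigenvalues, hence at least \<open>lambda_sec\<close>. Two vertices are needed for that
  complement to be nonzero.\<close>

lemma lambda_sec_laplacian:
  assumes card: "CARD('n) \<ge> 2"
  shows "lambda_sec (laplacian \<omega>) > 0"
    and "(\<Sum>i\<in>UNIV. y $ i) = 0 \<Longrightarrow> lambda_sec (laplacian \<omega>) * (y \<bullet> y) \<le> y \<bullet> (laplacian \<omega> *v y)"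
proof -
  let ?L = "laplacian \<omega>"
  define S where "S = {x::real^'n. 1 \<bullet> x = 0}"
  have one: "(1::real^'n) \<bullet> x = (\<Sum>i\<in>UNIV. x $ i)" for x by (simp add: inner_vec_def)
  have subS: "subspace S" unfolding S_def by (rule subspace_hyperplane)
  have invS: "?L *v x \<in> S" for x
    by (simp add: S_def symmetric_matrix_inner[OF laplacian_symmetric] laplacian_one)
  have "\<exists>x\<in>S. x \<noteq> 0"
  proof -
    obtain a b :: 'n where ab: "a \<noteq> b"
      by (metis (full_types) card UNIV_I card_2_iff' card_le_Suc0_iff_eq finite
          not_less_eq_eq numeral_2_eq_2)
    let ?x = "axis a 1 - axis b (1::real)"
    have "?x \<in> S" by (simp add: S_def inner_diff_right inner_axis)
    moreover have "?x $ a = 1" using ab by (simp add: axis_def)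
    then have "?x \<noteq> 0" by (metis zero_index zero_neq_one)
    ultimately show ?thesis by blast
  qed
  from rayleigh_minimiser[OF laplacian_symmetric subS invS this]
  obtain x l where x: "x \<in> S" "x \<noteq> 0" "?L *v x = l *\<^sub>R x"
    and bound: "\<And>y. y \<in> S \<Longrightarrow> l * (y \<bullet> y) \<le> y \<bullet> (?L *v y)"
    by blast
  have lspec: "l \<in> spectrum ?L" using x by (auto simp: spectrum_def eigenspace_def)
  have "l \<noteq> 0"
  proof
    assume "l = 0"
    then have "x \<in> span {1}" using x eigenspace_laplacian_0 by (auto simp: eigenspace_def)
    then show False using x by (auto simp: span_singleton S_def)
  qed
  let ?rep = "\<lambda>l. replicate_mset (dim (eigenspace ?L l)) l"
  let ?Y = "\<Sum>l\<in>spectrum ?L - {0}. ?rep l"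
  have fin: "finite (spectrum ?L)" by (rule finite_spectrum[OF laplacian_symmetric])
  \<comment> \<open>Exactly one copy of 0 is split off; all other entries are positive, so index 1
    of the full list is index 0 of the rest.\<close>
  have "dim (eigenspace ?L 0) = 1"
    unfolding eigenspace_laplacian_0 dim_span by simp
  then have "(\<Sum>l\<in>spectrum ?L. ?rep l) = add_mset 0 ?Y"
    using sum.remove[OF fin zero_in_laplacian_spectrum, of ?rep] by simp
  then have list: "eigenvalue_list ?L = insort 0 (sorted_list_of_multiset ?Y)"
    by (simp add: eigenvalue_list_def)
  define ys where "ys = sorted_list_of_multiset ?Y"
  have setY: "set ys = (\<Union>l\<in>spectrum ?L - {0}. set_mset (?rep l))"
    unfolding ys_def using fin by (simp add: set_mset_sum)
  have pos: "y > 0" if "y \<in> set ys" for y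
    using that laplacian_spectrum_nonneg unfolding setY by (force split: if_splits)
  have "dim (eigenspace ?L l) \<noteq> 0"
    using x by (auto simp: eigenspace_def)
  then have lys: "l \<in> set ys" unfolding setY using lspec \<open>l \<noteq> 0\<close> by auto
  have "insort 0 ys = 0 # ys"
    by (rule insort_is_Cons) (use pos in \<open>auto simp: less_imp_le\<close>)
  then have sec: "lambda_sec ?L = ys ! 0"
    unfolding lambda_sec_def list by (simp flip: ys_def)
  have "ys \<noteq> []" using lys by auto
  then show "lambda_sec ?L > 0" unfolding sec by (intro pos nth_mem) simp
  have "sorted ys" by (simp add: ys_def)
  with lys have "ys ! 0 \<le> l" by (cases ys) auto
  then have "lambda_sec ?L * (y \<bullet> y) \<le> l * (y \<bullet> y)" unfolding sec by (simp add: mult_right_mono)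
  then show "lambda_sec ?L * (y \<bullet> y) \<le> y \<bullet> (?L *v y)" if "(\<Sum>i\<in>UNIV. y $ i) = 0"
    using bound[of y] that by (simp add: S_def one)
qed

end

end

section \<open>Free energy\<close>

text \<open>For symmetric \<open>W\<close> this is the Euclidean gradient of
  \<open>free_energy W V \<beta>\<close> at vectors with positive entries, not projected to the
  tangent space of the simplex.\<close>

definition energy_gradient :: "real^'n^'n \<Rightarrow> real^'n \<Rightarrow> real \<Rightarrow> real^'n \<Rightarrow> real^'n::finite" where
  "energy_gradient W V \<beta> \<rho> = (\<chi> i. (W *v \<rho>) $ i + V $ i + \<beta> * (ln (\<rho> $ i) + 1))"

section \<open>Derivatives along curves, partial derivatives and the Hessian\<close>

lemma has_vector_derivative_matrix_vector:
  fixes A :: "real^'n^'m"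
  assumes "(x has_vector_derivative v) F"
  shows "((\<lambda>t. A *v x t) has_vector_derivative A *v v) F"
  by (rule bounded_linear.has_vector_derivative[OF matrix_vector_mul_bounded_linear assms])

lemma has_real_derivative_vec_nth:
  fixes x :: "real \<Rightarrow> real^'n"
  assumes "(x has_vector_derivative v) F"
  shows "((\<lambda>t. x t $ i) has_real_derivative v $ i) F"
  using bounded_linear.has_vector_derivative[OF bounded_linear_vec_nth assms]
  by (simp add: has_real_derivative_iff_has_vector_derivative)

text \<open>Stated along a curve and within a set, so that one computation serves coordinate lines,
  segments in the simplex and the flow on the half-line.\<close>

lemma free_energy_has_real_derivative:
  fixes x :: "real \<Rightarrow> real^'n::finite"
  assumes sym: "transpose W = W" and x: "(x has_vector_derivative v) (at t within S)"
    and pos: "\<And>i. x t $ i > 0"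
  shows "((\<lambda>t. free_energy W V \<beta> (x t)) has_real_derivative energy_gradient W V \<beta> (x t) \<bullet> v)
    (at t within S)"
proof -
  have eq: "free_energy W V \<beta> \<rho> = 1/2 * (\<Sum>i\<in>UNIV. \<rho> $ i * (W *v \<rho>) $ i) + (\<Sum>i\<in>UNIV. V $ i * \<rho> $ i)
      + \<beta> * (\<Sum>i\<in>UNIV. \<rho> $ i * ln (\<rho> $ i))" for \<rho>
    by (simp add: free_energy_def inner_vec_def)
  note d = has_real_derivative_vec_nth[OF x]
    has_real_derivative_vec_nth[OF has_vector_derivative_matrix_vector[OF x, of W]]
  have ent: "((\<lambda>t. x t $ i * ln (x t $ i)) has_real_derivative v $ i * (ln (x t $ i) + 1)) (at t within S)" for i
    using pos[of i] less_imp_neq[OF pos[of i], symmetric]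
    by (auto intro!: derivative_eq_intros d simp: distrib_left)
  have "((\<lambda>t. free_energy W V \<beta> (x t)) has_real_derivative
      1/2 * (\<Sum>i\<in>UNIV. v $ i * (W *v x t) $ i + x t $ i * (W *v v) $ i) + (\<Sum>i\<in>UNIV. V $ i * v $ i)
      + \<beta> * (\<Sum>i\<in>UNIV. v $ i * (ln (x t $ i) + 1))) (at t within S)"
    unfolding eq
    by (rule derivative_eq_intros refl d ent)+ (simp add: algebra_simps)
  \<comment> \<open>Symmetry of \<open>W\<close> merges the two halves of the derivative of the
    quadratic form and absorbs the factor 1/2.\<close>
  moreover have "(\<Sum>i\<in>UNIV. x t $ i * (W *v v) $ i) = (\<Sum>i\<in>UNIV. v $ i * (W *v x t) $ i)"
    using symmetric_matrix_inner[OF sym, of "x t" v] by (simp add: inner_vec_def mult.commute)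
  ultimately show ?thesis
    by (simp add: energy_gradient_def inner_vec_def sum.distrib sum_distrib_left algebra_simps)
qed

lemma energy_gradient_has_real_derivative:
  fixes x :: "real \<Rightarrow> real^'n::finite"
  assumes x: "(x has_vector_derivative v) (at t within S)" and pos: "x t $ i > 0"
  shows "((\<lambda>t. energy_gradient W V \<beta> (x t) $ i) has_real_derivative
    (W *v v) $ i + \<beta> * v $ i / x t $ i) (at t within S)"
  unfolding energy_gradient_def
  using pos has_real_derivative_vec_nth[OF x]
    has_real_derivative_vec_nth[OF has_vector_derivative_matrix_vector[OF x, of W]]
  by (auto intro!: derivative_eq_intros)

lemma line_has_vector_derivative:
  "((\<lambda>s. \<rho> + s *\<^sub>R d) has_vector_derivative d) (at s within S)"
  by (auto intro!: derivative_eq_intros)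

lemma partial_free_energy:
  fixes \<rho> :: "real^'n::finite"
  assumes "transpose W = W" "\<And>i. \<rho> $ i > 0"
  shows "partial j (free_energy W V \<beta>) \<rho> = energy_gradient W V \<beta> \<rho> $ j"
  unfolding partial_def
  using free_energy_has_real_derivative[OF assms(1) line_has_vector_derivative[of \<rho> "axis j 1" 0 UNIV],
    where V = V and \<beta> = \<beta>]
    assms(2)
  by (intro DERIV_imp_deriv) (simp add: inner_axis)

text \<open>The inner partial derivative equals the gradient entry only at positive points, while
  the outer \<open>deriv\<close> needs equality in a neighbourhood; positivity persists there by
  continuity.\<close>

lemma hessian_free_energy:
  fixes \<rho> :: "real^'n::finite"
  assumes sym: "transpose W = W" and pos: "\<And>i. \<rho> $ i > 0"
  shows "hessian (free_energy W V \<beta>) \<rho> = (\<chi> i j. W $ i $ j + (if i = j then \<beta> / \<rho> $ i else 0))"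
proof -
  have "partial i (partial j (free_energy W V \<beta>)) \<rho> = W $ i $ j + (if i = j then \<beta> / \<rho> $ i else 0)" for i j
  proof -
    have cont: "continuous (at 0) (\<lambda>s. (\<rho> + s *\<^sub>R axis i 1) $ k)" for k
      by (intro continuous_intros)
    have "\<forall>\<^sub>F s in nhds 0. (\<rho> + s *\<^sub>R axis i 1) $ k > 0" for k
    proof -
      have "\<forall>\<^sub>F s in at 0. 0 < (\<rho> + s *\<^sub>R axis i 1) $ k"
        by (rule order_tendstoD(1)[OF cont[unfolded continuous_at]]) (simp add: pos)
      then show ?thesis by (subst eventually_nhds_conv_at) (simp add: pos)
    qed
    then have "\<forall>\<^sub>F s in nhds 0. \<forall>k. (\<rho> + s *\<^sub>R axis i 1) $ k > 0"
      by (simp add: eventually_all_finite)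
    then have ev: "\<forall>\<^sub>F s in nhds 0. partial j (free_energy W V \<beta>) (\<rho> + s *\<^sub>R axis i 1)
        = energy_gradient W V \<beta> (\<rho> + s *\<^sub>R axis i 1) $ j"
      by (rule eventually_mono) (simp add: partial_free_energy[OF sym])
    have "partial i (partial j (free_energy W V \<beta>)) \<rho>
        = deriv (\<lambda>s. energy_gradient W V \<beta> (\<rho> + s *\<^sub>R axis i 1) $ j) 0"
      unfolding partial_def[of i] by (rule deriv_cong_ev[OF ev refl])
    also have "\<dots> = (W *v axis i 1) $ j + \<beta> * axis i 1 $ j / \<rho> $ j"
      using energy_gradient_has_real_derivative[OF line_has_vector_derivative[of \<rho> "axis i 1" 0 UNIV],
        where i = j and W = W and V = V and \<beta> = \<beta>]
        pos by (intro DERIV_imp_deriv) simp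
    also have "(W *v axis i 1) $ j = W $ i $ j"
      using sym by (simp add: matrix_vector_mult_basis column_def) (metis transpose_def vec_lambda_beta)
    finally show ?thesis by (auto simp: axis_def)
  qed
  then show ?thesis by (simp add: hessian_def)
qed

lemma hessian_mult:
  fixes \<rho> :: "real^'n::finite"
  assumes "transpose W = W" "\<And>i. \<rho> $ i > 0"
  shows "hessian (free_energy W V \<beta>) \<rho> *v x = (\<chi> i. (W *v x) $ i + \<beta> * x $ i / \<rho> $ i)"
  unfolding hessian_free_energy[OF assms]
  by (simp add: vec_eq_iff matrix_vector_mult_def distrib_right sum.distrib
      if_distrib[where f = "\<lambda>x. x * _"] cong: if_cong)

lemma hessian_symmetric:
  fixes \<rho> :: "real^'n::finite"
  assumes "transpose W = W" "\<And>i. \<rho> $ i > 0"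
  shows "transpose (hessian (free_energy W V \<beta>) \<rho>) = hessian (free_energy W V \<beta>) \<rho>"
  unfolding hessian_free_energy[OF assms] using assms(1)
  by (auto simp: transpose_def vec_eq_iff)

section \<open>Strong convexity and the Polyak-Lojasiewicz inequality\<close>

text \<open>The real-valued infimum bounds its members only if they are bounded below. The entropy
  adds a nonnegative diagonal to \<open>W\<close>, so \<open>lambda_min W\<close> is such a
  bound.\<close>

lemma hess_lambda_min_le:
  fixes \<rho> :: "real^'n::finite"
  assumes sym: "transpose W = W" and "\<beta> > 0" and \<rho>: "\<rho> \<in> simplex_int"
  shows "hess_lambda_min (free_energy W V \<beta>) * (x \<bullet> x) \<le> x \<bullet> (hessian (free_energy W V \<beta>) \<rho> *v x)"
proof -
  let ?H = "hessian (free_energy W V \<beta>)"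
  have "lambda_min W \<le> lambda_min (?H \<rho>)" if "\<rho> \<in> simplex_int" for \<rho>
  proof -
    have pos: "\<rho> $ i > 0" for i using that by (simp add: simplex_int_def)
    obtain x where x: "?H \<rho> *v x = lambda_min (?H \<rho>) *\<^sub>R x" "x \<noteq> 0"
      using lambda_min_symmetric(1)[OF hessian_symmetric[OF sym pos]]
      by (auto simp: spectrum_def eigenspace_def)
    have "lambda_min W * (x \<bullet> x) \<le> x \<bullet> (W *v x)" by (rule lambda_min_symmetric(2)[OF sym])
    also have "\<dots> \<le> x \<bullet> (?H \<rho> *v x)"
      unfolding hessian_mult[OF sym pos] inner_vec_def
      using pos \<open>\<beta> > 0\<close>
      by (intro sum_mono) (simp add: distrib_left less_imp_le mult.left_commute)
    also have "\<dots> = lambda_min (?H \<rho>) * (x \<bullet> x)" by (simp add: x)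
    finally show ?thesis using x by simp
  qed
  then have "bdd_below ((\<lambda>\<rho>. lambda_min (?H \<rho>)) ` simplex_int)" by (intro bdd_belowI[of _ "lambda_min W"]) auto
  then have "hess_lambda_min (free_energy W V \<beta>) \<le> lambda_min (?H \<rho>)"
    unfolding hess_lambda_min_def using \<rho> by (intro cINF_lower)
  then have "hess_lambda_min (free_energy W V \<beta>) * (x \<bullet> x) \<le> lambda_min (?H \<rho>) * (x \<bullet> x)"
    by (simp add: mult_right_mono)
  also have "\<dots> \<le> x \<bullet> (?H \<rho> *v x)"
    using \<rho> by (intro lambda_min_symmetric(2) hessian_symmetric[OF sym]) (simp add: simplex_int_def)
  finally show ?thesis .
qed

text \<open>The segment from \<open>p\<close> to \<open>q\<close> stays in the open simplex, and the
  Hessian bound is integrated twice along it: first for the directional derivative, then for the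
  energy.\<close>

lemma free_energy_strongly_convex:
  fixes p q :: "real^'n::finite"
  assumes sym: "transpose W = W" and "\<beta> > 0" and p: "p \<in> simplex_int" and q: "q \<in> simplex_int"
  shows "free_energy W V \<beta> p + energy_gradient W V \<beta> p \<bullet> (q - p)
      + hess_lambda_min (free_energy W V \<beta>) / 2 * ((q - p) \<bullet> (q - p)) \<le> free_energy W V \<beta> q"
proof -
  define F where "F = free_energy W V \<beta>"
  define G where "G = energy_gradient W V \<beta>"
  define k where "k = hess_lambda_min F"
  define d where "d = q - p"
  define x where "x s = p + s *\<^sub>R d" for s
  have xS: "x s \<in> simplex_int" if "0 \<le> s" "s \<le> 1" for s
  proof -
    have "x s = (1 - s) *\<^sub>R p + s *\<^sub>R q" by (simp add: x_def d_def algebra_simps)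
    moreover have "(1 - s) * p $ i + s * q $ i > 0" for i
    proof -
      have "p $ i > 0" "q $ i > 0" using p q by (simp_all add: simplex_int_def)
      then show ?thesis using that by (cases "s = 0") (simp_all add: add_nonneg_pos)
    qed
    ultimately show ?thesis using p q
      by (simp add: simplex_int_def sum.distrib flip: sum_distrib_left)
  qed
  have dx: "(x has_vector_derivative d) (at s within S)" for s S
    unfolding x_def by (rule line_has_vector_derivative)
  have x0: "x 0 = p" and x1: "x 1 = q" by (simp_all add: x_def d_def)
  have der: "(G (x 0) \<bullet> d) + k * s * (d \<bullet> d) \<le> G (x s) \<bullet> d" if s: "0 \<le> s" "s \<le> 1" for s
  proof -
    define \<phi> where "\<phi> s = G (x s) \<bullet> d - k * s * (d \<bullet> d)" for s
    have "\<phi> 0 \<le> \<phi> s"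
    proof (rule DERIV_nonneg_imp_nondecreasing[OF s(1)])
      fix u assume u: "0 \<le> u" "u \<le> s"
      then have xu: "x u \<in> simplex_int" using s xS by auto
      then have pos: "x u $ i > 0" for i by (simp add: simplex_int_def)
      have gi: "((\<lambda>s. G (x s) $ i) has_real_derivative (W *v d) $ i + \<beta> * d $ i / x u $ i) (at u)" for i
        unfolding G_def by (intro energy_gradient_has_real_derivative dx pos)
      have "((\<lambda>s. G (x s) \<bullet> d) has_real_derivative d \<bullet> (hessian F (x u) *v d)) (at u)"
        unfolding F_def hessian_mult[OF sym pos] inner_vec_def
        by (auto intro!: derivative_eq_intros gi sum.cong simp: mult.commute)
      then have "(\<phi> has_real_derivative d \<bullet> (hessian F (x u) *v d) - k * (d \<bullet> d)) (at u)"
        unfolding \<phi>_def by (auto intro!: derivative_eq_intros)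
      moreover have "d \<bullet> (hessian F (x u) *v d) - k * (d \<bullet> d) \<ge> 0"
        using hess_lambda_min_le[OF sym \<open>\<beta> > 0\<close> xu, of V d] by (simp add: F_def k_def)
      ultimately show "\<exists>y. (\<phi> has_real_derivative y) (at u) \<and> 0 \<le> y"
        by blast
    qed
    then show ?thesis by (simp add: \<phi>_def)
  qed
  \<comment> \<open>The energy minus its claimed quadratic lower bound, up to a constant;
    \<open>der\<close> says that its derivative is nonnegative.\<close>
  define \<psi> where "\<psi> s = F (x s) - s * (G (x 0) \<bullet> d) - k / 2 * s\<^sup>2 * (d \<bullet> d)" for s
  have "\<psi> 0 \<le> \<psi> 1"
  proof (rule DERIV_nonneg_imp_nondecreasing[OF zero_le_one])
    fix u :: real assume u: "0 \<le> u" "u \<le> 1"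
    then have pos: "x u $ i > 0" for i using xS[of u] by (simp add: simplex_int_def)
    have "((\<lambda>s. F (x s)) has_real_derivative G (x u) \<bullet> d) (at u)"
      unfolding F_def G_def by (rule free_energy_has_real_derivative[OF sym dx pos])
    then have "(\<psi> has_real_derivative G (x u) \<bullet> d - G (x 0) \<bullet> d - k * u * (d \<bullet> d)) (at u)"
      unfolding \<psi>_def by (auto intro!: derivative_eq_intros)
    moreover have "G (x u) \<bullet> d - G (x 0) \<bullet> d - k * u * (d \<bullet> d) \<ge> 0" using der[OF u] by simp
    ultimately show "\<exists>y. (\<psi> has_real_derivative y) (at u) \<and> 0 \<le> y" by blast
  qed
  then show ?thesis by (simp add: \<psi>_def x0 x1 F_def G_def k_def d_def)
qed

text \<open>The difference of two points of the simplex is orthogonal to constants, so the gradient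
  may be shifted by any \<open>c\<close>. Both uses rely on this freedom: \<open>c\<close> is the
  mean of the gradient in the Poincare step, and at the Gibbs measure it makes \<open>v\<close>
  vanish.\<close>

lemma polyak_lojasiewicz:
  fixes p q :: "real^'n::finite"
  assumes sym: "transpose W = W" and "\<beta> > 0" and p: "p \<in> simplex_int" and q: "q \<in> simplex_int"
    and k: "hess_lambda_min (free_energy W V \<beta>) > 0"
    and v: "v = energy_gradient W V \<beta> p - c *\<^sub>R 1"
  shows "2 * hess_lambda_min (free_energy W V \<beta>) * (free_energy W V \<beta> p - free_energy W V \<beta> q) \<le> v \<bullet> v"
proof -
  define k where "k = hess_lambda_min (free_energy W V \<beta>)"
  define d where "d = q - p"
  have "(1::real^'n) \<bullet> d = 0" using p q by (simp add: d_def inner_vec_def simplex_int_def sum_subtractf)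
  then have "energy_gradient W V \<beta> p \<bullet> d = v \<bullet> d" by (simp add: v inner_diff_left)
  then have "free_energy W V \<beta> p - free_energy W V \<beta> q \<le> - (v \<bullet> d) - k / 2 * (d \<bullet> d)"
    using free_energy_strongly_convex[OF sym \<open>\<beta> > 0\<close> p q, of V] by (simp add: d_def k_def)
  then have "2 * k * (free_energy W V \<beta> p - free_energy W V \<beta> q) \<le> 2 * k * (- (v \<bullet> d) - k / 2 * (d \<bullet> d))"
    using k by (intro mult_left_mono) (auto simp: k_def)
  \<comment> \<open>Completing the square in \<open>d\<close> removes all dependence on
    \<open>q\<close> from the upper bound.\<close>
  also have "\<dots> = v \<bullet> v - (v + k *\<^sub>R d) \<bullet> (v + k *\<^sub>R d)"
    by (simp add: inner_commute algebra_simps)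
  also have "\<dots> \<le> v \<bullet> v" by simp
  finally show ?thesis by (simp add: k_def)
qed

section \<open>The Gibbs measure as minimiser\<close>

lemma gibbs_measure_simplex:
  assumes "gibbs_measure W V \<beta> \<rho>"
  shows "\<rho> \<in> simplex_int"
proof -
  define K where "K = (\<Sum>j\<in>UNIV. exp (- ((W *v \<rho>) $ j + V $ j) / \<beta>))"
  have K: "K > 0" unfolding K_def by (intro sum_pos) auto
  have \<rho>: "\<rho> $ i = 1 / K * exp (- ((W *v \<rho>) $ i + V $ i) / \<beta>)" for i
    using assms by (simp add: gibbs_measure_def Let_def K_def)
  have "\<rho> $ i > 0" for i using K by (subst \<rho>) simp
  moreover have "(\<Sum>i\<in>UNIV. \<rho> $ i) = 1 / K * K"
    by (subst \<rho>) (simp add: K_def flip: sum_divide_distrib)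
  ultimately show ?thesis using K by (simp add: simplex_int_def)
qed

lemma gibbs_measure_minimises:
  assumes sym: "transpose W = W" and \<beta>: "\<beta> > 0" and gibbs: "gibbs_measure W V \<beta> \<rho>inf"
    and k: "hess_lambda_min (free_energy W V \<beta>) > 0" and \<rho>: "\<rho> \<in> simplex_int"
  shows "free_energy W V \<beta> \<rho>inf \<le> free_energy W V \<beta> \<rho>"
proof -
  define K where "K = (\<Sum>j\<in>UNIV. exp (- ((W *v \<rho>inf) $ j + V $ j) / \<beta>))"
  have K: "K > 0" unfolding K_def by (intro sum_pos) auto
  have "\<rho>inf $ i = 1 / K * exp (- ((W *v \<rho>inf) $ i + V $ i) / \<beta>)" for i
    using gibbs by (simp add: gibbs_measure_def Let_def K_def)
  then have "ln (\<rho>inf $ i) = - ((W *v \<rho>inf) $ i + V $ i) / \<beta> - ln K" for i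
    using K by (simp add: ln_div)
  \<comment> \<open>The logarithm of the fixed-point equation says that the gradient is constant
    across vertices, so the inequality at \<open>\<rho>inf\<close> has right-hand side 0.\<close>
  then have "0 = energy_gradient W V \<beta> \<rho>inf - (\<beta> * (1 - ln K)) *\<^sub>R 1"
    using \<beta> by (simp add: energy_gradient_def vec_eq_iff field_simps)
  from polyak_lojasiewicz[OF sym \<beta> gibbs_measure_simplex[OF gibbs] \<rho> k this]
  show ?thesis using k by (simp add: mult_le_0_iff)
qed

text \<open>Discrete integration by parts: exchanging \<open>i\<close> and \<open>j\<close> gives a
  second form of the same sum, and the two are averaged.\<close>

lemma sum_symmetric_exchange:
  fixes a :: "'n::finite \<Rightarrow> 'n \<Rightarrow> real"
  assumes "\<And>i j. a i j = a j i"
  shows "(\<Sum>i\<in>UNIV. h i * (\<Sum>j\<in>UNIV. a i j * (g j - g i)))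
    = - 1/2 * (\<Sum>i\<in>UNIV. \<Sum>j\<in>UNIV. a i j * ((h i - h j) * (g i - g j)))"
proof -
  define T where "T = (\<Sum>i\<in>UNIV. \<Sum>j\<in>UNIV. a i j * h i * (g j - g i))"
  have "T = (\<Sum>i\<in>UNIV. \<Sum>j\<in>UNIV. a j i * h j * (g i - g j))"
    unfolding T_def by (rule sum.swap)
  also have "\<dots> = (\<Sum>i\<in>UNIV. \<Sum>j\<in>UNIV. a i j * h j * (g i - g j))"
    by (subst assms) (rule refl)
  finally have "T + T = (\<Sum>i\<in>UNIV. \<Sum>j\<in>UNIV. a i j * h i * (g j - g i) + a i j * h j * (g i - g j))"
    by (simp add: T_def sum.distrib)
  also have "\<dots> = - (\<Sum>i\<in>UNIV. \<Sum>j\<in>UNIV. a i j * ((h i - h j) * (g i - g j)))"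
    unfolding sum_negf[symmetric] by (intro sum.cong refl) (simp add: algebra_simps)
  moreover have "(\<Sum>i\<in>UNIV. h i * (\<Sum>j\<in>UNIV. a i j * (g j - g i))) = T"
    by (simp add: T_def sum_distrib_left mult_ac)
  ultimately show ?thesis by simp
qed

section \<open>The flow\<close>

text \<open>Drift and diffusion combine into differences of the gradient, and vanishing weights off
  the edges allow sums over all vertices.\<close>

lemma fokker_planck_rhs_gradient:
  fixes \<rho> :: "real^'n::finite"
  assumes "weighted_graph E \<omega>"
  shows "fokker_planck_rhs E \<omega> W V \<beta> \<rho> $ i = (\<Sum>j\<in>UNIV. \<omega> $ i $ j * edge_mean \<rho> i j *
    (energy_gradient W V \<beta> \<rho> $ j - energy_gradient W V \<beta> \<rho> $ i))"
proof -
  have "fokker_planck_rhs E \<omega> W V \<beta> \<rho> $ i = (\<Sum>j\<in>nbhd E i. \<omega> $ i $ j * edge_mean \<rho> i j *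
    (energy_gradient W V \<beta> \<rho> $ j - energy_gradient W V \<beta> \<rho> $ i))"
    by (simp add: fokker_planck_rhs_def energy_gradient_def sum_distrib_left flip: sum.distrib)
      (intro sum.cong refl, simp add: algebra_simps)
  also have "\<dots> = (\<Sum>j\<in>UNIV. \<omega> $ i $ j * edge_mean \<rho> i j *
    (energy_gradient W V \<beta> \<rho> $ j - energy_gradient W V \<beta> \<rho> $ i))"
    by (intro sum.mono_neutral_left) (auto simp: nbhd_def weight_eq_0[OF assms])
  finally show ?thesis .
qed

text \<open>The weak form of the flow. Testing with the gradient gives the dissipation; testing with
  the indicator of \<open>S\<close> gives the rate of change of the mass of
  \<open>S\<close>.\<close>

lemma inner_fokker_planck_rhs:
  fixes \<rho> :: "real^'n::finite"
  assumes "weighted_graph E \<omega>"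
  shows "(\<Sum>i\<in>UNIV. h i * fokker_planck_rhs E \<omega> W V \<beta> \<rho> $ i) =
    - 1/2 * (\<Sum>i\<in>UNIV. \<Sum>j\<in>UNIV. \<omega> $ i $ j * edge_mean \<rho> i j *
    ((h i - h j) * (energy_gradient W V \<beta> \<rho> $ i - energy_gradient W V \<beta> \<rho> $ j)))"
proof -
  have "\<omega> $ i $ j * edge_mean \<rho> i j = \<omega> $ j $ i * edge_mean \<rho> j i" for i j
  proof -
    have "\<omega> $ i $ j = \<omega> $ j $ i" using assms unfolding weighted_graph_def by blast
    then show ?thesis by (simp add: edge_mean_def add.commute)
  qed
  then show ?thesis unfolding fokker_planck_rhs_gradient[OF assms]
    by (rule sum_symmetric_exchange)
qed

text \<open>Edge means of masses at least \<open>m\<close> are at least \<open>m\<close>; since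
  weights and squares are nonnegative, the comparison with the plain Laplacian holds term by
  term.\<close>

lemma dissipation_le:
  fixes \<rho> :: "real^'n::finite"
  assumes graph: "weighted_graph E \<omega>" and m: "\<And>i. m \<le> \<rho> $ i"
  shows "energy_gradient W V \<beta> \<rho> \<bullet> fokker_planck_rhs E \<omega> W V \<beta> \<rho>
    \<le> - m * (energy_gradient W V \<beta> \<rho> \<bullet> (laplacian \<omega> *v energy_gradient W V \<beta> \<rho>))"
proof -
  let ?g = "energy_gradient W V \<beta> \<rho>"
  have "m * (?g \<bullet> (laplacian \<omega> *v ?g)) = 1/2 * (\<Sum>(i, j)\<in>E. \<omega> $ i $ j * m * (?g $ i - ?g $ j)\<^sup>2)"
    unfolding laplacian_quadratic_form[OF graph]
    by (simp add: sum_distrib_left split_def mult_ac)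
  also have "(\<Sum>(i, j)\<in>E. \<omega> $ i $ j * m * (?g $ i - ?g $ j)\<^sup>2)
      = (\<Sum>(i, j)\<in>UNIV. \<omega> $ i $ j * m * (?g $ i - ?g $ j)\<^sup>2)"
    by (intro sum.mono_neutral_left) (auto simp: weight_eq_0[OF graph])
  also have "\<dots> = (\<Sum>i\<in>UNIV. \<Sum>j\<in>UNIV. \<omega> $ i $ j * m * (?g $ i - ?g $ j)\<^sup>2)"
    by (simp add: sum.cartesian_product)
  also have "\<dots> \<le> (\<Sum>i\<in>UNIV. \<Sum>j\<in>UNIV. \<omega> $ i $ j * edge_mean \<rho> i j * ((?g $ i - ?g $ j) * (?g $ i - ?g $ j)))"
  proof (intro sum_mono)
    fix i j
    have "m \<le> edge_mean \<rho> i j" using m[of i] m[of j] by (simp add: edge_mean_def)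
    then show "\<omega> $ i $ j * m * (?g $ i - ?g $ j)\<^sup>2
        \<le> \<omega> $ i $ j * edge_mean \<rho> i j * ((?g $ i - ?g $ j) * (?g $ i - ?g $ j))"
      unfolding power2_eq_square
      by (intro mult_right_mono mult_left_mono weight_nonneg[OF graph]) auto
  qed
  finally show ?thesis
    using inner_fokker_planck_rhs[OF graph, of "\<lambda>i. ?g $ i" W V \<beta> \<rho>] by (simp add: inner_vec_def)
qed

section \<open>Lower bound for the masses along the flow\<close>

lemma connected_graph_crossing_edge:
  assumes "connected_graph E" "S \<noteq> {}" "S \<noteq> UNIV"
  obtains i j where "(i, j) \<in> E" "i \<in> S" "j \<notin> S"
proof -
  obtain a b where ab: "a \<in> S" "b \<notin> S" using assms by blast
  have "(a, b) \<in> E\<^sup>*" using assms(1) by (simp add: connected_graph_def)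
  then have "b \<in> S \<or> (\<exists>i j. (i, j) \<in> E \<and> i \<in> S \<and> j \<notin> S)"
    by (induction rule: rtrancl_induct) (use ab in auto)
  then show ?thesis using ab that by blast
qed

text \<open>At the first time one of the functions vanishes its derivative would have to be nonpositive.\<close>

lemma barrier:
  fixes f D :: "'i \<Rightarrow> real \<Rightarrow> real"
  assumes fin: "finite I" and init: "\<And>i. i \<in> I \<Longrightarrow> f i 0 > 0"
    and der: "\<And>i t. i \<in> I \<Longrightarrow> t \<ge> 0 \<Longrightarrow> (f i has_real_derivative D i t) (at t within {0..})"
    and inward: "\<And>i t. i \<in> I \<Longrightarrow> t \<ge> 0 \<Longrightarrow> (\<And>j. j \<in> I \<Longrightarrow> f j t \<ge> 0) \<Longrightarrow> f i t = 0 \<Longrightarrow> D i t > 0"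
    and "i \<in> I" "t \<ge> 0"
  shows "f i t > 0"
proof (rule ccontr)
  assume neg: "\<not> f i t > 0"
  have cont: "continuous_on {0..} (f i)" if "i \<in> I" for i
    using der[OF that] by (intro DERIV_continuous_on) auto
  \<comment> \<open>The times at which some function is nonpositive. Finiteness of \<open>I\<close>
    makes this set closed, so its infimum is attained.\<close>
  define Z where "Z = (\<Union>i\<in>I. {t \<in> {0..}. f i t \<le> 0})"
  have "closed Z" unfolding Z_def
    by (intro closed_UN fin ballI continuous_on_closed_Collect_le cont) auto
  moreover have "Z \<noteq> {}" using neg \<open>i \<in> I\<close> \<open>t \<ge> 0\<close> by (auto simp: Z_def not_less)
  moreover have bdd: "bdd_below Z" by (rule bdd_belowI[of _ 0]) (auto simp: Z_def)
  ultimately have "Inf Z \<in> Z" by (intro closed_contains_Inf)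
  define T where "T = Inf Z"
  obtain k where k: "k \<in> I" "f k T \<le> 0" "T \<ge> 0" using \<open>Inf Z \<in> Z\<close> by (auto simp: Z_def T_def)
  have "T \<noteq> 0" using k init[of k] by auto
  with k have T: "T > 0" by simp
  have before: "f j s > 0" if "j \<in> I" "0 \<le> s" "s < T" for j s
    using cInf_lower[OF _ bdd, of s] that by (fastforce simp: Z_def T_def not_less)
  have at: "f j T \<ge> 0" if "j \<in> I" for j
  proof (rule tendsto_lowerbound)
    have "at T within {0..} = at T" using T by (intro at_within_interior) simp
    moreover have "(f j \<longlongrightarrow> f j T) (at T within {0..})"
      using cont[OF that] T by (simp add: continuous_on_def)
    ultimately show "(f j \<longlongrightarrow> f j T) (at_left T)"
      by (metis subset_UNIV tendsto_within_subset)
    show "\<forall>\<^sub>F s in at_left T. 0 \<le> f j s"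
      using before[OF that] T by (intro eventually_at_leftI[of 0]) (auto intro: less_imp_le)
  qed simp
  then have zero: "f k T = 0" using k by force
  then have "D k T > 0" using inward[of k T] k at by blast
  \<comment> \<open>A positive derivative at a zero forces negative values just before
    \<open>T\<close>, where all functions are still positive.\<close>
  from has_real_derivative_pos_inc_left[OF der[OF k(1,3)] this]
  obtain d where d: "d > 0" "\<And>h. h > 0 \<Longrightarrow> T - h \<in> {0..} \<Longrightarrow> h < d \<Longrightarrow> f k (T - h) < f k T" by blast
  define h where "h = min (d / 2) (T / 2)"
  have h: "0 < h" "h < d" "h < T" using d T by (auto simp: h_def min_def)
  have "f k (T - h) < f k T" using h by (intro d) auto
  then show False using before[of k "T - h"] k zero h by simp
qed

text \<open>As the masses sum to 1, the potential at \<open>i\<close> is the \<rho>-average of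
  \<open>W $ i $ j + V $ i\<close>, hence bounded by half of
  \<open>ln (M_const W V)\<close>.\<close>

lemma potential_difference_le:
  fixes \<rho> :: "real^'n::finite"
  assumes "\<rho> \<in> simplex_int"
  shows "(W *v \<rho>) $ i + V $ i - ((W *v \<rho>) $ j + V $ j) \<le> ln (M_const W V)"
proof -
  define Q where "Q = Max (range (\<lambda>(i, j). \<bar>V $ i\<bar> + \<bar>W $ i $ j\<bar>))"
  have Q: "\<bar>V $ i\<bar> + \<bar>W $ i $ j\<bar> \<le> Q" for i j
    unfolding Q_def by (rule Max_ge) (auto intro!: image_eqI[of _ _ "(i, j)"])
  have "\<bar>(W *v \<rho>) $ i + V $ i\<bar> \<le> Q" for i
  proof -
    have "(W *v \<rho>) $ i + V $ i = (\<Sum>j\<in>UNIV. (W $ i $ j + V $ i) * \<rho> $ j)"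
      using assms by (simp add: matrix_vector_mult_def simplex_int_def distrib_right sum.distrib
          flip: sum_distrib_left)
    also have "\<bar>\<dots>\<bar> \<le> (\<Sum>j\<in>UNIV. Q * \<rho> $ j)"
    proof (rule order_trans[OF sum_abs], rule sum_mono)
      fix j
      have "\<bar>W $ i $ j + V $ i\<bar> \<le> Q" using Q[of i j] by linarith
      then show "\<bar>(W $ i $ j + V $ i) * \<rho> $ j\<bar> \<le> Q * \<rho> $ j"
        using assms by (auto simp: abs_mult simplex_int_def less_imp_le intro!: mult_mono)
    qed
    also have "\<dots> = Q" using assms by (simp add: simplex_int_def flip: sum_distrib_left)
    finally show ?thesis .
  qed
  from this[of i] this[of j] have "(W *v \<rho>) $ i + V $ i - ((W *v \<rho>) $ j + V $ j) \<le> 2 * Q" by linarith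
  then show ?thesis by (simp add: M_const_def Q_def)
qed

text \<open>The mass ratio makes the entropic gap at least \<open>ln (2 * M)\<close>, while
  potentials differ by at most \<open>ln M\<close>; the factor 2 gives strictness.\<close>

lemma energy_gradient_less:
  fixes \<rho> :: "real^'n::finite"
  assumes \<rho>: "\<rho> \<in> simplex_int" and \<beta>: "\<beta> > 0"
    and le: "(2 * M_const W V) powr (1/\<beta>) * \<rho> $ i \<le> \<rho> $ j"
  shows "energy_gradient W V \<beta> \<rho> $ i < energy_gradient W V \<beta> \<rho> $ j"
proof -
  define M where "M = M_const W V"
  have M: "M > 0" by (simp add: M_def M_const_def)
  have pos: "\<rho> $ i > 0" "\<rho> $ j > 0" using \<rho> by (auto simp: simplex_int_def)
  have "ln (2 * M) / \<beta> + ln (\<rho> $ i) = ln ((2 * M) powr (1/\<beta>) * \<rho> $ i)"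
    using M pos by (simp add: ln_mult_pos ln_powr)
  also have "\<dots> \<le> ln (\<rho> $ j)"
    using le M pos by (subst ln_le_cancel_iff) (auto simp: M_def)
  finally have "ln (2 * M) + \<beta> * ln (\<rho> $ i) \<le> \<beta> * ln (\<rho> $ j)"
    using \<beta> by (simp add: field_simps)
  moreover have "ln (2 * M) = ln 2 + ln M" using M by (simp add: ln_mult_pos)
  moreover have "ln (2::real) > 0" by simp
  ultimately have "(W *v \<rho>) $ i + V $ i + \<beta> * ln (\<rho> $ i) < (W *v \<rho>) $ j + V $ j + \<beta> * ln (\<rho> $ j)"
    using potential_difference_le[OF \<rho>, of W i V j] unfolding M_def by linarith
  then show ?thesis by (simp add: energy_gradient_def distrib_left)
qed

text \<open>With the indicator of \<open>S\<close> as test function only edges crossing the boundary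
  of \<open>S\<close> contribute. Each carries mass towards the lower gradient, that is into
  \<open>S\<close>, and connectedness supplies at least one.\<close>

lemma sum_fokker_planck_rhs_pos:
  fixes \<rho> :: "real^'n::finite"
  assumes graph: "weighted_graph E \<omega>" and conn: "connected_graph E" and \<rho>: "\<rho> \<in> simplex_int"
    and S: "S \<noteq> {}" "S \<noteq> UNIV"
    and less: "\<And>i j. i \<in> S \<Longrightarrow> j \<notin> S \<Longrightarrow> energy_gradient W V \<beta> \<rho> $ i < energy_gradient W V \<beta> \<rho> $ j"
  shows "(\<Sum>i\<in>S. fokker_planck_rhs E \<omega> W V \<beta> \<rho> $ i) > 0"
proof -
  let ?g = "energy_gradient W V \<beta> \<rho>"
  let ?h = "\<lambda>i. if i \<in> S then 1 else 0 :: real"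
  let ?t = "\<lambda>i j. \<omega> $ i $ j * edge_mean \<rho> i j * ((?h i - ?h j) * (?g $ i - ?g $ j))"
  have mean: "edge_mean \<rho> i j > 0" for i j
    using \<rho> by (auto simp: edge_mean_def simplex_int_def intro!: add_pos_pos)
  have prod: "(?h i - ?h j) * (?g $ i - ?g $ j) \<le> 0" for i j
    using less[of i j] less[of j i] by auto
  have t: "?t i j \<le> 0" for i j
    by (rule mult_nonneg_nonpos[OF mult_nonneg_nonneg[OF weight_nonneg[OF graph] less_imp_le[OF mean]] prod])
  obtain a b where ab: "(a, b) \<in> E" "a \<in> S" "b \<notin> S"
    using connected_graph_crossing_edge[OF conn S] .
  have "\<omega> $ a $ b > 0" using graph ab unfolding weighted_graph_def by blast
  then have tab: "?t a b < 0" using ab less[of a b] mean[of a b] by (simp add: mult_pos_neg)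
  have "(\<Sum>j\<in>UNIV. ?t a j) < (\<Sum>j\<in>(UNIV::'n set). 0)"
  proof (rule sum_strict_mono_ex1)
    show "\<forall>j\<in>UNIV. ?t a j \<le> 0" by (intro ballI t)
    show "\<exists>j\<in>UNIV. ?t a j < 0" using tab by blast
  qed simp
  then have row: "(\<Sum>j\<in>UNIV. ?t a j) < 0" by simp
  have "(\<Sum>i\<in>UNIV. \<Sum>j\<in>UNIV. ?t i j) < (\<Sum>i\<in>(UNIV::'n set). 0)"
  proof (rule sum_strict_mono_ex1)
    show "\<forall>i\<in>UNIV. (\<Sum>j\<in>UNIV. ?t i j) \<le> 0" by (intro ballI sum_nonpos t)
    show "\<exists>i\<in>UNIV. (\<Sum>j\<in>UNIV. ?t i j) < 0" using row by blast
  qed simp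
  moreover have "(\<Sum>i\<in>S. fokker_planck_rhs E \<omega> W V \<beta> \<rho> $ i)
      = (\<Sum>i\<in>UNIV. ?h i * fokker_planck_rhs E \<omega> W V \<beta> \<rho> $ i)"
    by (simp add: if_distrib[where f = "\<lambda>x. x * _"] sum.If_cases)
  ultimately show ?thesis unfolding inner_fokker_planck_rhs[OF graph] by simp
qed

lemma m_const_bounds:
  fixes \<rho>0 :: "real^'n::finite"
  assumes "\<rho>0 \<in> simplex_int"
  shows "0 < m_const W V \<beta> \<rho>0" "m_const W V \<beta> \<rho>0 \<le> 1" "m_const W V \<beta> \<rho>0 \<le> \<rho>0 $ i"
proof -
  define R where "R = (2 * M_const W V) powr (1/\<beta>)"
  define q where "q = 1 / (1 + R)"
  have "R \<ge> 0" by (simp add: R_def)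
  then have q: "0 < q" "q \<le> 1" by (auto simp: q_def)
  define a where "a = Min (range (\<lambda>i. \<rho>0 $ i))"
  have a: "a > 0" unfolding a_def using assms by (subst Min_gr_iff) (auto simp: simplex_int_def)
  have ai: "a \<le> \<rho>0 $ i" unfolding a_def by (intro Min_le) auto
  have m: "m_const W V \<beta> \<rho>0 = 1/2 * q ^ (CARD('n) - 2) * min q a"
    by (simp add: m_const_def q_def R_def a_def)
  show "0 < m_const W V \<beta> \<rho>0" using q a by (simp add: m)
  have p: "0 < q ^ (CARD('n) - 2)" "q ^ (CARD('n) - 2) \<le> 1" using q by (auto intro: power_le_one)
  have "m_const W V \<beta> \<rho>0 \<le> 1 * min q a"
    unfolding m using p q a by (intro mult_right_mono) auto
  then show "m_const W V \<beta> \<rho>0 \<le> 1" "m_const W V \<beta> \<rho>0 \<le> \<rho>0 $ i" using q ai by auto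
qed

text \<open>Lower barriers for the masses of all proper vertex sets \<open>S\<close>, not only singletons: when
  the mass of \<open>S\<close> reaches its barrier, the barriers for \<open>insert j S\<close> force every vertex
  outside \<open>S\<close> to carry at least \<open>(2M) powr (1/\<beta>)\<close> times the mass of any vertex in \<open>S\<close>.\<close>

lemma fokker_planck_lower_bound:
  fixes \<rho> :: "real \<Rightarrow> real^'n::finite"
  assumes card: "CARD('n) \<ge> 2" and graph: "weighted_graph E \<omega>" and conn: "connected_graph E"
    and \<beta>: "\<beta> > 0" and \<rho>0: "\<rho>0 \<in> simplex_int"
    and sol: "fokker_planck_solution E \<omega> W V \<beta> \<rho>0 \<rho>" and t: "t \<ge> 0"
  shows "m_const W V \<beta> \<rho>0 \<le> \<rho> t $ i"
proof -
  define R where "R = (2 * M_const W V) powr (1/\<beta>)"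
  define q where "q = 1 / (1 + R)"
  have R: "R \<ge> 0" by (simp add: R_def)
  have q: "0 < q" "q \<le> 1" "q * (1 + R) = 1" using R by (auto simp: q_def)
  define a where "a = Min (range (\<lambda>i. \<rho>0 $ i))"
  have a: "a > 0" unfolding a_def using \<rho>0 by (subst Min_gr_iff) (auto simp: simplex_int_def)
  have ai: "a \<le> \<rho>0 $ i" for i unfolding a_def by (intro Min_le) auto
  \<comment> \<open>The factor 1/2 puts \<open>e\<close> strictly below all initial masses, and
    \<open>e \<le> q\<close> gives \<open>e * (1 + R) \<le> 1\<close>, used when a single vertex
    lies outside \<open>S\<close>.\<close>
  define e where "e = 1/2 * min q a"
  \<comment> \<open>The exponent is 0 for complements of single vertices and
    \<open>CARD('n) - 2\<close> for singletons, where \<open>thr\<close> becomes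
    \<open>m_const\<close>. Adding a vertex multiplies the barrier by
    \<open>1 / q = 1 + R\<close>.\<close>
  define thr where "thr S = e * q ^ (CARD('n) - card S - 1)" for S :: "'n set"
  have e: "e > 0" "e < a" "e * (1 + R) \<le> 1"
  proof -
    show "e > 0" "e < a" using q a by (auto simp: e_def min_def)
    have "e * (1 + R) \<le> q * (1 + R)" using R q a by (intro mult_right_mono) (auto simp: e_def min_def)
    then show "e * (1 + R) \<le> 1" using q by simp
  qed
  have thr_e: "thr S \<le> e" for S
    unfolding thr_def using e q by (simp add: power_le_one mult_left_le)
  define I where "I = {S::'n set. S \<noteq> {} \<and> S \<noteq> UNIV}"
  have simplex: "\<rho> t \<in> simplex_int" if "t \<ge> 0" for t
    using sol that by (simp add: fokker_planck_solution_def)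
  have init: "(\<Sum>i\<in>S. \<rho> 0 $ i) - thr S > 0" if S: "S \<in> I" for S
  proof -
    obtain i where i: "i \<in> S" using S by (auto simp: I_def)
    have "thr S < \<rho>0 $ i" using thr_e[of S] e ai[of i] by linarith
    also have "\<dots> \<le> (\<Sum>i\<in>S. \<rho>0 $ i)"
      using \<rho>0 i by (intro member_le_sum) (auto simp: simplex_int_def less_imp_le)
    finally show ?thesis using sol by (simp add: fokker_planck_solution_def)
  qed
  have der: "((\<lambda>t. (\<Sum>i\<in>S. \<rho> t $ i) - thr S) has_real_derivative
      (\<Sum>i\<in>S. fokker_planck_rhs E \<omega> W V \<beta> (\<rho> t) $ i)) (at t within {0..})" if "t \<ge> 0" for S t
  proof -
    have "(\<rho> has_vector_derivative fokker_planck_rhs E \<omega> W V \<beta> (\<rho> t)) (at t within {0..})"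
      using sol that by (simp add: fokker_planck_solution_def)
    from has_real_derivative_vec_nth[OF this] show ?thesis
      by (auto intro!: derivative_eq_intros)
  qed
  have inward: "(\<Sum>i\<in>S. fokker_planck_rhs E \<omega> W V \<beta> (\<rho> t) $ i) > 0"
    if S: "S \<in> I" and t: "t \<ge> 0" and all: "\<And>S. S \<in> I \<Longrightarrow> (\<Sum>i\<in>S. \<rho> t $ i) - thr S \<ge> 0"
      and zero: "(\<Sum>i\<in>S. \<rho> t $ i) - thr S = 0" for S t
  proof (rule sum_fokker_planck_rhs_pos[OF graph conn simplex[OF t]])
    show "S \<noteq> {}" "S \<noteq> UNIV" using S by (auto simp: I_def)
    fix i j assume i: "i \<in> S" and j: "j \<notin> S"
    have pos: "\<rho> t $ i > 0" for i using simplex[OF t] by (simp add: simplex_int_def)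
    have "\<rho> t $ i \<le> (\<Sum>i\<in>S. \<rho> t $ i)" using i pos by (intro member_le_sum) (auto simp: less_imp_le)
    also have "\<dots> = thr S" using zero by simp
    finally have "R * \<rho> t $ i \<le> R * thr S" using R by (rule mult_left_mono)
    also have "R * thr S \<le> \<rho> t $ j"
    \<comment> \<open>If \<open>j\<close> is the only vertex outside \<open>S\<close>, the total
      mass 1 replaces the barrier for \<open>insert j S\<close>. Otherwise that barrier exceeds
      \<open>thr S\<close> by \<open>R * thr S\<close>, which \<open>j\<close> alone must
      supply.\<close>
    proof (cases "insert j S = UNIV")
      case True
      have "1 = (\<Sum>i\<in>insert j S. \<rho> t $ i)" using simplex[OF t] by (simp add: simplex_int_def True)
      then have "\<rho> t $ j = 1 - thr S" using j zero by simp
      moreover have "thr S * (1 + R) \<le> e * (1 + R)" using R thr_e by (intro mult_right_mono) auto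
      ultimately show ?thesis using e by (simp add: algebra_simps)
    next
      case False
      \<comment> \<open>Properness of \<open>insert j S\<close> rules out truncated subtraction in
        the exponents.\<close>
      have "card (insert j S) < CARD('n)" using False by (intro psubset_card_mono) auto
      then have "CARD('n) - card S - 1 = Suc (CARD('n) - card (insert j S) - 1)" using j by simp
      then have "thr S = thr (insert j S) * q" by (simp add: thr_def)
      then have "(1 + R) * thr S = thr (insert j S)" using q(3) by (simp add: mult_ac)
      moreover have "thr (insert j S) \<le> (\<Sum>i\<in>insert j S. \<rho> t $ i)"
        using all[of "insert j S"] False by (simp add: I_def)
      moreover have "(\<Sum>i\<in>insert j S. \<rho> t $ i) = \<rho> t $ j + thr S" using j zero by simp
      ultimately show ?thesis by (simp add: algebra_simps)
    qed
    finally show "energy_gradient W V \<beta> (\<rho> t) $ i < energy_gradient W V \<beta> (\<rho> t) $ j"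
      unfolding R_def by (rule energy_gradient_less[OF simplex[OF t] \<beta>])
  qed
  have "{i} \<in> I"
  proof -
    have "{i} \<noteq> UNIV" using card by (metis card_1_singleton_iff One_nat_def not_less_eq_eq numeral_2_eq_2 order_refl)
    then show ?thesis by (simp add: I_def)
  qed
  from barrier[of I "\<lambda>S t. (\<Sum>i\<in>S. \<rho> t $ i) - thr S"
      "\<lambda>S t. \<Sum>i\<in>S. fokker_planck_rhs E \<omega> W V \<beta> (\<rho> t) $ i", OF _ init der inward this t]
  have "thr {i} < \<rho> t $ i" by simp
  moreover have "m_const W V \<beta> \<rho>0 = thr {i}"
    by (simp add: m_const_def thr_def e_def q_def R_def a_def numeral_2_eq_2)
  ultimately show ?thesis by simp
qed

section \<open>The spectral gap and the decay rate\<close>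

text \<open>Subtracting its mean makes the gradient admissible for the spectral gap, leaves the
  Laplacian form unchanged, and is a shift allowed by \<open>polyak_lojasiewicz\<close>; one
  \<open>v\<close> links both inequalities.\<close>

lemma poincare_energy_gradient:
  fixes p q :: "real^'n::finite"
  assumes card: "CARD('n) \<ge> 2" and graph: "weighted_graph E \<omega>" and conn: "connected_graph E"
    and \<beta>: "\<beta> > 0" and sym: "transpose W = W"
    and k: "hess_lambda_min (free_energy W V \<beta>) > 0"
    and p: "p \<in> simplex_int" and q: "q \<in> simplex_int"
  shows "2 * lambda_sec (laplacian \<omega>) * hess_lambda_min (free_energy W V \<beta>)
      * (free_energy W V \<beta> p - free_energy W V \<beta> q)
    \<le> energy_gradient W V \<beta> p \<bullet> (laplacian \<omega> *v energy_gradient W V \<beta> p)"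
proof -
  let ?L = "laplacian \<omega>" and ?g = "energy_gradient W V \<beta> p"
  define c where "c = (\<Sum>i\<in>UNIV. ?g $ i) / CARD('n)"
  define v where "v = ?g - c *\<^sub>R 1"
  have sum0: "(\<Sum>i\<in>UNIV. v $ i) = 0" by (simp add: v_def sum_subtractf c_def)
  have Lv: "?L *v v = ?L *v ?g"
    by (simp add: v_def matrix_vector_mult_diff_distrib matrix_vector_mult_scaleR laplacian_one[OF graph])
  have "1 \<bullet> (?L *v ?g) = 0"
    by (simp add: symmetric_matrix_inner[OF laplacian_symmetric[OF graph]] laplacian_one[OF graph])
  then have "v \<bullet> (?L *v v) = ?g \<bullet> (?L *v ?g)" unfolding Lv by (simp add: v_def inner_diff_left)
  moreover have "lambda_sec ?L * (v \<bullet> v) \<le> v \<bullet> (?L *v v)"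
    by (rule lambda_sec_laplacian(2)[OF graph conn card sum0])
  moreover have "lambda_sec ?L * (2 * hess_lambda_min (free_energy W V \<beta>)
      * (free_energy W V \<beta> p - free_energy W V \<beta> q)) \<le> lambda_sec ?L * (v \<bullet> v)"
    using lambda_sec_laplacian(1)[OF graph conn card]
    by (intro mult_left_mono polyak_lojasiewicz[OF sym \<beta> p q k v_def]) simp
  ultimately show ?thesis by (simp add: mult_ac)
qed

text \<open>Every norm is nonnegative, but the supremum dominates one of them only if the family is
  bounded above. On the invariant region the diagonal term is at most
  \<open>\<beta> / m_const W V \<beta> \<rho>0\<close>, and \<open>\<rho>0\<close> itself lies in
  the region.\<close>

lemma hess_norm1_nonneg:
  fixes \<rho>0 :: "real^'n::finite"
  assumes sym: "transpose W = W" and \<beta>: "\<beta> > 0" and \<rho>0: "\<rho>0 \<in> simplex_int"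
  shows "0 \<le> hess_norm1 (free_energy W V \<beta>) (invariant_region W V \<beta> \<rho>0)"
proof -
  let ?H = "hessian (free_energy W V \<beta>)" and ?m = "m_const W V \<beta> \<rho>0"
  let ?K = "invariant_region W V \<beta> \<rho>0"
  have m: "?m > 0" by (rule m_const_bounds(1)[OF \<rho>0])
  have nonneg: "0 \<le> mat_norm1 A" for A :: "real^'n^'n"
    unfolding mat_norm1_def by (subst Max_ge_iff) (auto intro: sum_nonneg)
  have "mat_norm1 (?H \<rho>) \<le> (\<Sum>j\<in>UNIV. \<Sum>i\<in>UNIV. \<bar>W $ i $ j\<bar> + \<beta> / ?m)" if "\<rho> \<in> ?K" for \<rho>
  proof -
    have pos: "\<rho> $ i > 0" and le: "?m \<le> \<rho> $ i" for i
      using that by (auto simp: invariant_region_def simplex_int_def)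
    have entry: "\<bar>?H \<rho> $ i $ j\<bar> \<le> \<bar>W $ i $ j\<bar> + \<beta> / ?m" for i j
    proof -
      have "0 \<le> \<beta> / \<rho> $ i" "\<beta> / \<rho> $ i \<le> \<beta> / ?m"
        using pos[of i] le[of i] \<beta> m by (auto intro: divide_left_mono)
      then show ?thesis by (auto simp: hessian_free_energy[OF sym pos])
    qed
    have "(\<Sum>i\<in>UNIV. \<bar>?H \<rho> $ i $ j\<bar>) \<le> (\<Sum>j\<in>UNIV. \<Sum>i\<in>UNIV. \<bar>W $ i $ j\<bar> + \<beta> / ?m)" for j
    proof -
      have "(\<Sum>i\<in>UNIV. \<bar>?H \<rho> $ i $ j\<bar>) \<le> (\<Sum>i\<in>UNIV. \<bar>W $ i $ j\<bar> + \<beta> / ?m)"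
        by (intro sum_mono entry)
      also have "\<dots> \<le> (\<Sum>j\<in>UNIV. \<Sum>i\<in>UNIV. \<bar>W $ i $ j\<bar> + \<beta> / ?m)"
        using m \<beta> by (intro member_le_sum[where f = "\<lambda>j. \<Sum>i\<in>UNIV. \<bar>W $ i $ j\<bar> + \<beta> / ?m"] sum_nonneg) auto
      finally show ?thesis .
    qed
    then show ?thesis unfolding mat_norm1_def by (subst Max_le_iff) auto
  qed
  then have "bdd_above ((\<lambda>\<rho>. mat_norm1 (?H \<rho>)) ` ?K)"
    by (intro bdd_aboveI2)
  moreover have "\<rho>0 \<in> ?K" using \<rho>0 m_const_bounds(3)[OF \<rho>0] by (simp add: invariant_region_def)
  ultimately show ?thesis
    unfolding hess_norm1_def using nonneg by (meson cSUP_upper order_trans)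
qed

lemma r_const_nonneg:
  fixes \<rho>0 :: "real^'n::finite"
  assumes card: "CARD('n) \<ge> 2" and graph: "weighted_graph E \<omega>" and conn: "connected_graph E"
    and \<beta>: "\<beta> > 0" and sym: "transpose W = W"
    and gibbs: "gibbs_measure W V \<beta> \<rho>inf" and \<rho>0: "\<rho>0 \<in> simplex_int"
    and k: "hess_lambda_min (free_energy W V \<beta>) > 0"
  shows "0 \<le> r_const E \<omega> W V \<beta> \<rho>0 \<rho>inf"
proof -
  \<comment> \<open>With two vertices, connectedness yields an edge, so \<open>max_weight\<close> is
    a \<open>Max\<close> over a nonempty set.\<close>
  have "UNIV \<noteq> {undefined :: 'n}"
    using card by (metis card_1_singleton_iff One_nat_def not_less_eq_eq numeral_2_eq_2 order_refl)
  then obtain i j where ij: "(i, j) \<in> E"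
    using connected_graph_crossing_edge[OF conn, of "{undefined}"] by blast
  have "\<omega> $ i $ j \<le> max_weight E \<omega>"
    unfolding max_weight_def by (intro Max_ge) (use ij in \<open>auto intro!: image_eqI[of _ _ "(i, j)"]\<close>)
  then have "max_weight E \<omega> \<ge> 0" using weight_nonneg[OF graph, of i j] by linarith
  then show ?thesis
    unfolding r_const_def Let_def
    using hess_norm1_nonneg[OF sym \<beta> \<rho>0, of V] m_const_bounds(2)[OF \<rho>0, of W V \<beta>]
      lambda_max_laplacian_nonneg[OF graph] gibbs_measure_minimises[OF sym \<beta> gibbs k \<rho>0]
    by (intro mult_nonneg_nonneg divide_nonneg_nonneg) auto
qed

theorem theorem5:
  fixes E :: "('n::finite \<times> 'n) set"
    and \<omega> W :: "real^'n^'n"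
    and V \<rho>0 \<rho>inf :: "real^'n"
    and \<beta> :: real
    and \<rho> :: "real \<Rightarrow> real^'n"
  assumes "CARD('n) \<ge> 2"
    and "weighted_graph E \<omega>" and "connected_graph E"
    and "\<beta> > 0" and "transpose W = W"
    and "gibbs_measure W V \<beta> \<rho>inf"
    and "\<rho>0 \<in> simplex_int"
    and "hess_lambda_min (free_energy W V \<beta>) > 0"
    and "fokker_planck_solution E \<omega> W V \<beta> \<rho>0 \<rho>"
  shows "\<exists>C>0.
    (\<forall>t\<ge>0. free_energy W V \<beta> (\<rho> t) - free_energy W V \<beta> \<rho>inf
        \<le> exp (- C * t) * (free_energy W V \<beta> \<rho>0 - free_energy W V \<beta> \<rho>inf)) \<and>
    C = 2 * m_const W V \<beta> \<rho>0 * lambda_sec (laplacian \<omega>) * hess_lambda_min (free_energy W V \<beta>)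
        * (1 / (r_const E \<omega> W V \<beta> \<rho>0 \<rho>inf + 1)^2)"
proof -
  note graph = assms(2) and conn = assms(3) and \<beta> = assms(4) and sym = assms(5)
    and gibbs = assms(6) and \<rho>0 = assms(7) and k = assms(8) and sol = assms(9)
  define m where "m = m_const W V \<beta> \<rho>0"
  define r where "r = r_const E \<omega> W V \<beta> \<rho>0 \<rho>inf"
  define A where "A = 2 * m * lambda_sec (laplacian \<omega>) * hess_lambda_min (free_energy W V \<beta>)"
  define C where "C = A * (1 / (r + 1)^2)"
  have m: "m > 0" unfolding m_def by (rule m_const_bounds(1)[OF \<rho>0])
  have r: "r \<ge> 0" unfolding r_def by (rule r_const_nonneg[OF assms(1-8)])
  have A: "A > 0" unfolding A_def using m k lambda_sec_laplacian(1)[OF graph conn assms(1)] by simp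
  have C: "0 < C" "C \<le> A"
  proof -
    have "1 \<le> (r + 1)^2" using r by simp
    then show "C \<le> A" "0 < C" using A r by (auto simp: C_def field_simps)
  qed
  define D where "D t = free_energy W V \<beta> (\<rho> t) - free_energy W V \<beta> \<rho>inf" for t
  define D' where "D' t = energy_gradient W V \<beta> (\<rho> t) \<bullet> fokker_planck_rhs E \<omega> W V \<beta> (\<rho> t)" for t
  have simplex: "\<rho> t \<in> simplex_int" if "t \<ge> 0" for t
    using sol that by (simp add: fokker_planck_solution_def)
  have D_nonneg: "D t \<ge> 0" if "t \<ge> 0" for t
    using gibbs_measure_minimises[OF sym \<beta> gibbs k simplex[OF that]] by (simp add: D_def)
  have der: "(D has_real_derivative D' t) (at t within {0..})" if "t \<ge> 0" for t
  proof -
    have "(\<rho> has_vector_derivative fokker_planck_rhs E \<omega> W V \<beta> (\<rho> t)) (at t within {0..})"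
      using sol that by (simp add: fokker_planck_solution_def)
    then have "((\<lambda>t. free_energy W V \<beta> (\<rho> t)) has_real_derivative D' t) (at t within {0..})"
      unfolding D'_def using simplex[OF that]
      by (intro free_energy_has_real_derivative[OF sym]) (auto simp: simplex_int_def)
    then show ?thesis unfolding D_def by (auto intro!: derivative_eq_intros)
  qed
  have decay: "D' t \<le> - C * D t" if t: "t \<ge> 0" for t
  proof -
    let ?g = "energy_gradient W V \<beta> (\<rho> t)"
    have "D' t \<le> - m * (?g \<bullet> (laplacian \<omega> *v ?g))"
      unfolding D'_def m_def
      by (intro dissipation_le[OF graph] fokker_planck_lower_bound[OF assms(1) graph conn \<beta> \<rho>0 sol t])
    moreover have "m * (2 * lambda_sec (laplacian \<omega>) * hess_lambda_min (free_energy W V \<beta>) * D t)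
        \<le> m * (?g \<bullet> (laplacian \<omega> *v ?g))"
      unfolding D_def using m
      by (intro mult_left_mono poincare_energy_gradient[OF assms(1) graph conn \<beta> sym k simplex[OF t]]
          gibbs_measure_simplex[OF gibbs]) simp
    \<comment> \<open>Weakening the rate from \<open>A\<close> to \<open>C\<close> is legitimate
      because the energy gap \<open>D t\<close> is nonnegative.\<close>
    moreover have "C * D t \<le> A * D t" using C D_nonneg[OF t] by (intro mult_right_mono) auto
    ultimately show ?thesis by (simp add: A_def mult_ac)
  qed
  \<comment> \<open>Integrating factor: the differential inequality for \<open>D\<close> says that
    \<open>\<phi>\<close> does not increase.\<close>
  define \<phi> where "\<phi> t = exp (C * t) * D t" for t
  have d\<phi>: "(\<phi> has_real_derivative exp (C * t) * (D' t + C * D t)) (at t within {0..})" if "t \<ge> 0" for t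
    unfolding \<phi>_def by (auto intro!: derivative_eq_intros der[OF that] simp: algebra_simps)
  have "D t \<le> exp (- C * t) * D 0" if t: "t \<ge> 0" for t
  proof -
    have "\<phi> t \<le> \<phi> 0"
    \<comment> \<open>At time 0 only a one-sided derivative exists, so two-sided derivatives are
      used at interior times and continuity at the endpoints.\<close>
    proof (rule DERIV_nonpos_imp_decreasing_open[OF t])
      fix s assume s: "0 < s" "s < t"
      then have "at s within {0..} = at s" by (intro at_within_interior) simp
      then have "(\<phi> has_real_derivative exp (C * s) * (D' s + C * D s)) (at s)"
        using d\<phi>[of s] s by simp
      moreover have "exp (C * s) * (D' s + C * D s) \<le> 0"
        using decay[of s] s by (simp add: mult_le_0_iff)
      ultimately show "\<exists>y. (\<phi> has_real_derivative y) (at s) \<and> y \<le> 0" by blast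
    next
      have "continuous_on {0..} \<phi>" using d\<phi> by (intro DERIV_continuous_on) auto
      then show "continuous_on {0..t} \<phi>" by (rule continuous_on_subset) auto
    qed
    then have "exp (- C * t) * (exp (C * t) * D t) \<le> exp (- C * t) * D 0"
      by (intro mult_left_mono) (auto simp: \<phi>_def)
    then show ?thesis by (simp add: exp_minus field_simps)
  qed
  moreover have "\<rho> 0 = \<rho>0" using sol by (simp add: fokker_planck_solution_def)
  ultimately show ?thesis
    using C by (intro exI[of _ C]) (auto simp: D_def C_def A_def m_def r_def)
qed

end
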